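(* Let $P$ be a finite partially ordered set with ground set $[n]$ and let $J(P)=\langle x_ix_j\mid \text{neither } i\preceq j\text{ nor }j\preceq i\text{ in }P\rangle\subset\mathbb{K}[x_1,\dots,x_n]$. Then $J(P)$ is differentially perfect. In particular, for all integers $r,s\ge1$, the symbolic powers of the antichain ideal $J(P)^{\{r\}}$ are $$\left(J(P)^{\{r\}}\right)^{(s)}=\Big\langle\prod_{i=1}^{l}m_{A_i}\ \Big|\ A_i\in\mathcal{A}_{r+1}(P)\text{ with }\sum_{i=1}^{l}(|A_i|-r)=s\Big\rangle .$$
   Context: $\mathbb{K}$ is an algebraically closed field and $R=\mathbb{K}[\mathbf{x}]=\mathbb{K}[x_1,\dots,x_n]$. For $A\subseteq[n]$, $m_A=\prod_{i\in A}x_i$. $\mathcal{A}_k(P)$ is the set of antichains of $P$ of cardinality at least $k$. In the generating set, $l\ge1$ is arbitrary and the $A_i$ need not be distinct. Symbolic power: $I^{(r)}=(R_I^{-1}I^r)\cap R$, where $R_I$ is the complement of the union of the minimal primes of $I$. Join and secant ideals: $I\ast J=\big(I(\mathbf{y})+J(\mathbf{z})+\langle x_i-y_i-z_i\mid i=1,\dots,n\rangle\big)\cap\mathbb{K}[\mathbf{x}]$, where $I(\mathbf{y})$ is $I$ with $y_i$ substituted for $x_i$; the $r$-th secant ideal is the $r$-fold join $I^{\{r\}}=I\ast\cdots\ast I$ (so $I^{\{1\}}=I$). An ideal $I$ is $r$-differentially perfect if for all $s\ge1$, $(I^{\{r\}})^{(s)}=I^{\{r+s-1\}}+\sum_{i=1}^{s-1}(I^{\{r\}})^{(i)}(I^{\{r\}})^{(s-i)}$;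 it is differentially perfect if it is $r$-differentially perfect for all $r\ge1$. *)

theory Defs
  imports
    "HOL-Algebra.Algebraic_Closure_Type"
    "HOL-Algebra.Ideal_Product"
    "HOL-Library.Poly_Mapping"
    "HOL-Library.Set_Algebras"
begin

text \<open>
  The polynomial ring with coefficients in \<open>'k\<close> and variables indexed by \<open>'v\<close> is the
  type \<open>('v \<Rightarrow>\<^sub>0 nat) \<Rightarrow>\<^sub>0 'k\<close>, with convolution product. Ideals of a commutative ring type are
  ideals in the sense of HOL-Algebra of the record \<^const>\<open>ring_of_type_algebra\<close>.
\<close>

type_synonym ('v, 'k) mpoly = "('v \<Rightarrow>\<^sub>0 nat) \<Rightarrow>\<^sub>0 'k"

definition Var :: "'v \<Rightarrow> ('v, 'k::comm_ring_1) mpoly" where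
  "Var i = Poly_Mapping.single (Poly_Mapping.single i 1) 1"

definition Const :: "'k \<Rightarrow> ('v, 'k::comm_ring_1) mpoly" where
  "Const c = Poly_Mapping.single 0 c"

definition rename :: "('v \<Rightarrow> 'w) \<Rightarrow> ('v, 'k) mpoly \<Rightarrow> ('w, 'k::comm_ring_1) mpoly" where
  "rename h f = (\<Sum>m \<in> Poly_Mapping.keys f. Const (Poly_Mapping.lookup f m) *
      (\<Prod>i \<in> Poly_Mapping.keys m. Var (h i) ^ Poly_Mapping.lookup m i))"

abbreviation ideal_generated :: "'a::comm_ring_1 set \<Rightarrow> 'a set" where
  "ideal_generated S \<equiv> genideal ring_of_type_algebra S"

abbreviation ideal_mult :: "'a::comm_ring_1 set \<Rightarrow> 'a set \<Rightarrow> 'a set" where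
  "ideal_mult I J \<equiv> ideal_prod ring_of_type_algebra I J"

abbreviation ideal_power :: "'a::comm_ring_1 set \<Rightarrow> nat \<Rightarrow> 'a set" where
  "ideal_power I r \<equiv> I [^]\<^bsub>ideals_set ring_of_type_algebra\<^esub> r"


section \<open>Symbolic powers\<close>

text \<open>Elements of the localization \<open>S\<^sup>-\<^sup>1R\<close> are the classes of pairs \<open>(a, s)\<close> under
  \<open>localization_rel S\<close>.\<close>

definition localization_rel :: "'a::comm_ring_1 set \<Rightarrow> (('a \<times> 'a) \<times> ('a \<times> 'a)) set" where
  "localization_rel S =
     {((a, s), (b, t)) |a s b t. s \<in> S \<and> t \<in> S \<and> (\<exists>u\<in>S. u * (t * a - s * b) = 0)}"

definition fraction :: "'a::comm_ring_1 set \<Rightarrow> 'a \<Rightarrow> 'a \<Rightarrow> ('a \<times> 'a) set" where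
  "fraction S a s = localization_rel S `` {(a, s)}"

definition localized_ideal :: "'a::comm_ring_1 set \<Rightarrow> 'a set \<Rightarrow> ('a \<times> 'a) set set" where
  "localized_ideal S I = {fraction S a s |a s. a \<in> I \<and> s \<in> S}"

definition minimal_primes :: "'a::comm_ring_1 set \<Rightarrow> 'a set set" where
  "minimal_primes I =
     {Q. primeideal Q ring_of_type_algebra \<and> I \<subseteq> Q \<and>
         (\<forall>Q'. primeideal Q' ring_of_type_algebra \<and> I \<subseteq> Q' \<and> Q' \<subseteq> Q \<longrightarrow> Q' = Q)}"

text \<open>The intersection with \<open>R\<close> is the preimage under the canonical map \<open>f \<mapsto> f/1\<close>.\<close>

definition symbolic_power :: "'a::comm_ring_1 set \<Rightarrow> nat \<Rightarrow> 'a set" where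
  "symbolic_power I r =
     (let S = - \<Union>(minimal_primes I)
      in {f. fraction S f 1 \<in> localized_ideal S (ideal_power I r)})"


section \<open>Joins and secant ideals\<close>

datatype 'v xyz = x_var 'v | y_var 'v | z_var 'v

text \<open>The intersection with \<open>K[x]\<close> is the preimage under the inclusion of \<open>K[x]\<close> in
  \<open>K[x,y,z]\<close>.\<close>

definition join_ideal ::
  "('v, 'k::comm_ring_1) mpoly set \<Rightarrow> ('v, 'k) mpoly set \<Rightarrow> ('v, 'k) mpoly set" where
  "join_ideal I J =
     {f. rename x_var f \<in> ideal_generated
           (rename y_var ` I \<union> rename z_var ` J \<union>
            {Var (x_var i) - Var (y_var i) - Var (z_var i) |i. True})}"

text \<open>The \<open>r\<close>-fold join for \<open>r \<ge> 1\<close>; the value at \<open>r = 0\<close> is irrelevant.\<close>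

definition secant_ideal :: "('v, 'k::comm_ring_1) mpoly set \<Rightarrow> nat \<Rightarrow> ('v, 'k) mpoly set" where
  "secant_ideal I r = (join_ideal I ^^ (r - 1)) I"


section \<open>Differentially perfect ideals\<close>

text \<open>Here \<open>+\<close> and \<open>\<Sum>\<close> are the elementwise sums of sets, that is, sums of ideals; the empty sum
  is the zero ideal.\<close>

definition r_differentially_perfect :: "nat \<Rightarrow> ('v, 'k::comm_ring_1) mpoly set \<Rightarrow> bool" where
  "r_differentially_perfect r I \<longleftrightarrow>
     (\<forall>s\<ge>1. symbolic_power (secant_ideal I r) s =
        secant_ideal I (r + s - 1) +
        (\<Sum>i = 1..s - 1. ideal_mult (symbolic_power (secant_ideal I r) i)
                                    (symbolic_power (secant_ideal I r) (s - i))))"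

definition differentially_perfect :: "('v, 'k::comm_ring_1) mpoly set \<Rightarrow> bool" where
  "differentially_perfect I \<longleftrightarrow> (\<forall>r\<ge>1. r_differentially_perfect r I)"


section \<open>Antichain ideals\<close>

definition incomparability_ideal :: "'n rel \<Rightarrow> ('n, 'k::comm_ring_1) mpoly set" where
  "incomparability_ideal P =
     ideal_generated {Var i * Var j |i j. (i, j) \<notin> P \<and> (j, i) \<notin> P}"

definition antichains :: "'n rel \<Rightarrow> nat \<Rightarrow> 'n set set" where
  "antichains P k =
     {A. (\<forall>i\<in>A. \<forall>j\<in>A. i \<noteq> j \<longrightarrow> (i, j) \<notin> P \<and> (j, i) \<notin> P) \<and> card A \<ge> k}"

definition squarefree_monomial :: "'n set \<Rightarrow> ('n, 'k::comm_ring_1) mpoly" where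
  "squarefree_monomial A = (\<Prod>i\<in>A. Var i)"

end

theory Submission
  imports Defs "HOL-Combinatorics.Cycles"
begin

text \<open>
  The complements of the unions of \<open>r\<close> chains index the components of the variety of
  \<open>J(P)\<^sup>{\<^sup>r\<^sup>}\<close>, which are coordinate subspaces: the join of two intersections of monomial primes
  \<open>P\<^sub>A\<close> and \<open>P\<^sub>B\<close> is the intersection of the primes \<open>P\<^bsub>A \<inter> B\<^esub>\<close>. The \<open>s\<close>-th symbolic power of
  such an intersection is spanned by the monomials \<open>x\<^sup>m\<close> whose degree in the variables of every
  \<open>A\<close> is at least \<open>s\<close>. Here this says that every union of \<open>r\<close> chains misses at
  least \<open>s\<close> elements of \<open>P\<close>, counted with the multiplicities \<open>m\<close>. By a weighted form of
  the theorem of Greene and Kleitman this is the case if and only if there are antichains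
  \<open>A\<^sub>i\<close> covering each element \<open>v\<close> at most \<open>m v\<close> times with \<open>\<Sum>(\<bar>A\<^sub>i\<bar> - r) \<ge> s\<close>, that is,
  \<open>x\<^sup>m\<close> is divisible by one of the claimed generators. The min-max theorem follows from duality for
  the assignment problem. A generator with a single antichain lies in \<open>J(P)\<^sup>{\<^sup>r\<^sup>+\<^sup>s\<^sup>-\<^sup>1\<^sup>}\<close>, any
  other one in a product of smaller symbolic powers.
\<close>

section \<open>The assignment problem\<close>

fun path_weight :: "('a \<Rightarrow> 'a \<Rightarrow> int) \<Rightarrow> 'a list \<Rightarrow> int" where
  "path_weight w (x # y # p) = w x y + path_weight w (y # p)"
| "path_weight w _ = 0"

lemma path_weight_snoc:
  "p \<noteq> [] \<Longrightarrow> path_weight w (p @ [z]) = path_weight w p + w (last p) z"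
  by (induction w p rule: path_weight.induct) auto

lemma path_weight_split:
  "path_weight w (p @ z # q) = path_weight w (p @ [z]) + path_weight w (z # q)"
proof (induction p)
  case (Cons x p)
  then show ?case by (cases p) auto
qed simp

text \<open>\<open>cycle_of_list cs\<close> sends each entry of \<open>cs\<close> to the next one,
  cyclically, so the edges of the closed walk are the pairs of an element and its image. This turns
  walks into permutations.\<close>

lemma path_weight_cycle:
  assumes "distinct cs" "cs \<noteq> []"
  shows "path_weight w (cs @ [hd cs]) = (\<Sum>x\<in>set cs. w x (cycle_of_list cs x))"
proof -
  have zip: "path_weight w (p @ [z]) = sum_list (map2 w p (tl p @ [z]))" if "p \<noteq> []" for p z
    using that
  proof (induction p)
    case (Cons x p)
    then show ?case by (cases p) auto
  qed simp
  have "map (cycle_of_list cs) cs = rotate1 cs"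
    using cyclic_rotation[of cs 1] assms by simp
  also have "\<dots> = tl cs @ [hd cs]"
    using assms by (cases cs) auto
  finally have rot: "map (cycle_of_list cs) cs = tl cs @ [hd cs]" .
  have "map2 w cs (map (cycle_of_list cs) cs) = map (\<lambda>x. w x (cycle_of_list cs x)) cs"
    by (intro nth_equalityI) auto
  then have "path_weight w (cs @ [hd cs]) = sum_list (map (\<lambda>x. w x (cycle_of_list cs x)) cs)"
    using zip[OF assms(2), of "hd cs"] by (simp add: rot)
  then show ?thesis
    using assms by (simp add: sum_list_distinct_conv_sum_set)
qed

text \<open>Shortest path distances do it: extending a shortest path to \<open>x\<close> by the edge
  to \<open>y\<close> gives a path to \<open>y\<close>, and if \<open>y\<close> was already visited,
  the closed walk cut off has nonnegative weight.\<close>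

lemma exists_potential:
  fixes w :: "'a \<Rightarrow> 'a \<Rightarrow> int"
  assumes fin: "finite S"
    and nonneg: "\<And>cs. \<lbrakk>distinct cs; cs \<noteq> []; set cs \<subseteq> S\<rbrakk> \<Longrightarrow> 0 \<le> path_weight w (cs @ [hd cs])"
  shows "\<exists>h. \<forall>x\<in>S. \<forall>y\<in>S. h y \<le> h x + w x y"
proof -
  \<comment> \<open>The starting vertex is free, so \<open>[y]\<close> is always a candidate for
    \<open>y\<close> in \<open>S\<close>; distinctness keeps the set finite, so that the minimum
    exists.\<close>
  define paths where "paths y = {p. p \<noteq> [] \<and> distinct p \<and> set p \<subseteq> S \<and> last p = y}" for y
  define h where "h y = Min (path_weight w ` paths y)" for y
  have finp: "finite (paths y)" for y
  proof (rule finite_subset)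
    show "paths y \<subseteq> {p. set p \<subseteq> S \<and> distinct p}"
      by (auto simp: paths_def)
  qed (use fin finite_subset_distinct in auto)
  have "h y \<le> h x + w x y" if xy: "x \<in> S" "y \<in> S" for x y
  proof -
    have "[x] \<in> paths x"
      using xy by (simp add: paths_def)
    then have "h x \<in> path_weight w ` paths x"
      unfolding h_def using finp by (intro Min_in) auto
    then obtain p where p: "p \<in> paths x" "h x = path_weight w p"
      by auto
    have le: "h y \<le> path_weight w q" if "q \<in> paths y" for q
      unfolding h_def using that finp by (intro Min_le) auto
    show ?thesis
    proof (cases "y \<in> set p")
      case False
      then have "p @ [y] \<in> paths y"
        using p xy by (auto simp: paths_def)
      from le[OF this] show ?thesis
        using p by (simp add: path_weight_snoc paths_def)
    next
      case True
      then obtain p1 p2 where split: "p = p1 @ y # p2"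
        by (meson split_list)
      have "p1 @ [y] \<in> paths y"
        using p split by (auto simp: paths_def)
      note le[OF this]
      moreover have "0 \<le> path_weight w ((y # p2) @ [hd (y # p2)])"
        using p split by (intro nonneg) (auto simp: paths_def)
      moreover have "path_weight w ((y # p2) @ [hd (y # p2)]) = path_weight w (y # p2) + w x y"
        using p split by (subst path_weight_snoc) (auto simp: paths_def)
      ultimately show ?thesis
        using p(2) path_weight_split[of w p1 y p2] split by simp
    qed
  qed
  then show ?thesis by blast
qed

text \<open>Rerouting an optimal permutation along a cycle cannot lower its cost. Hence the graph of
  rerouting costs has no negative cycle, and its potential yields the dual solution.\<close>

lemma assignment_duality:
  fixes c :: "'a \<Rightarrow> 'a \<Rightarrow> int"
  assumes fin: "finite S" and perm: "\<sigma> permutes S"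
    and opt: "\<And>\<tau>. \<tau> permutes S \<Longrightarrow> (\<Sum>x\<in>S. c x (\<sigma> x)) \<le> (\<Sum>x\<in>S. c x (\<tau> x))"
  shows "\<exists>a b. (\<forall>x\<in>S. \<forall>y\<in>S. a x + b y \<le> c x y) \<and>
           (\<Sum>x\<in>S. a x + b x) = (\<Sum>x\<in>S. c x (\<sigma> x))"
proof -
  \<comment> \<open>The change in cost when \<open>x\<close> takes over the target of
    \<open>y\<close> under \<open>\<sigma>\<close>.\<close>
  define w where "w x y = c x (\<sigma> y) - c x (\<sigma> x)" for x y
  have "0 \<le> path_weight w (cs @ [hd cs])" if cs: "distinct cs" "cs \<noteq> []" "set cs \<subseteq> S" for cs
  proof -
    let ?\<tau> = "cycle_of_list cs"
    have out: "x \<notin> set cs \<Longrightarrow> w x (?\<tau> x) = 0" for x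
      using id_outside_supp[of x cs] by (simp add: w_def)
    have "?\<tau> permutes S"
      using cycle_permutes cs(3) permutes_subset by blast
    then have "0 \<le> (\<Sum>x\<in>S. c x ((\<sigma> \<circ> ?\<tau>) x)) - (\<Sum>x\<in>S. c x (\<sigma> x))"
      using opt[OF permutes_compose[OF _ perm]] by simp
    also have "\<dots> = (\<Sum>x\<in>S. w x (?\<tau> x))"
      by (simp add: w_def sum_subtractf)
    also have "\<dots> = (\<Sum>x\<in>set cs. w x (?\<tau> x))"
      using fin cs out by (intro sum.mono_neutral_right) auto
    finally show ?thesis
      using cs by (simp add: path_weight_cycle)
  qed
  from exists_potential[OF fin this] obtain h
    where h: "\<And>x y. \<lbrakk>x \<in> S; y \<in> S\<rbrakk> \<Longrightarrow> h y \<le> h x + w x y"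
    by blast
  \<comment> \<open>Chosen so that the dual constraint is tight at every pair
    \<open>(x, \<sigma> x)\<close>; this gives equality of the two objective values.\<close>
  define a where "a x = c x (\<sigma> x) - h x" for x
  define b where "b y = h (inv_into UNIV \<sigma> y)" for y
  have "a x + b y \<le> c x y" if "x \<in> S" "y \<in> S" for x y
    using h[OF that(1), of "inv_into UNIV \<sigma> y"] that permutes_inverses[OF perm]
      permutes_in_image[OF permutes_inv[OF perm]]
    by (simp add: a_def b_def w_def)
  moreover have "(\<Sum>x\<in>S. b x) = (\<Sum>x\<in>S. h x)"
    unfolding b_def using sum.permute[OF permutes_inv[OF perm], of h] by (simp add: o_def)
  then have "(\<Sum>x\<in>S. a x + b x) = (\<Sum>x\<in>S. c x (\<sigma> x))"
    by (simp add: a_def sum.distrib sum_subtractf)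
  ultimately show ?thesis by blast
qed

section \<open>Unions of chains and antichains\<close>

text \<open>Empty chains are allowed, so these are the unions of at most \<open>r\<close>
  chains.\<close>

definition chain_unions :: "'a rel \<Rightarrow> nat \<Rightarrow> 'a set set" where
  "chain_unions P r = {\<Union>i<r. c i |c. \<forall>i<r. c i \<in> Chains P}"

lemma chain_unions_1: "chain_unions P (Suc 0) = Chains P"
  unfolding chain_unions_def by (auto simp: lessThan_Suc)

lemma chain_unions_Suc:
  "chain_unions P (Suc r) = {C \<union> D |C D. C \<in> Chains P \<and> D \<in> chain_unions P r}" (is "?L = ?R")
proof
  show "?L \<subseteq> ?R"
  proof
    fix S assume "S \<in> ?L"
    then obtain c where "S = (\<Union>i<Suc r. c i)" "\<forall>i<Suc r. c i \<in> Chains P"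
      unfolding chain_unions_def by blast
    then have "S = c r \<union> (\<Union>i<r. c i)" "c r \<in> Chains P" "(\<Union>i<r. c i) \<in> chain_unions P r"
      by (auto simp: lessThan_Suc chain_unions_def)
    then show "S \<in> ?R" by blast
  qed
  show "?R \<subseteq> ?L"
  proof
    fix S assume "S \<in> ?R"
    then obtain C c where C: "S = C \<union> (\<Union>i<r. c i)" "C \<in> Chains P" "\<forall>i<r. c i \<in> Chains P"
      unfolding chain_unions_def by auto
    then have "S = (\<Union>i<Suc r. (c(r := C)) i)" "\<forall>i<Suc r. (c(r := C)) i \<in> Chains P"
      by (auto simp: lessThan_Suc)
    then show "S \<in> ?L"
      unfolding chain_unions_def by blast
  qed
qed

text \<open>Each point of \<open>F\<close> is added as a one-element chain, and empty chains make up
  the difference to \<open>k\<close>.\<close>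

lemma chain_unions_Un_finite:
  assumes "refl P" "C \<in> chain_unions P r" "finite F" "card F \<le> k"
  shows "C \<union> F \<in> chain_unions P (r + k)"
  using assms(3,4)
proof (induction F arbitrary: k)
  case empty
  have "C \<in> chain_unions P (r + k)"
  proof (induction k)
    case (Suc k)
    have "{} \<in> Chains P" by (simp add: Chains_def)
    with Suc show ?case by (auto simp: chain_unions_Suc)
  qed (simp add: assms)
  then show ?case by simp
next
  case (insert x F)
  then obtain j where j: "k = Suc j" "card F \<le> j"
    by (cases k) auto
  have "{x} \<in> Chains P"
    using assms(1) by (auto simp: Chains_def refl_on_def)
  with insert.IH[OF j(2)] show ?case
    unfolding j(1) add_Suc_right chain_unions_Suc
    by (intro CollectI exI[of _ "{x}"] exI[of _ "C \<union> F"]) auto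
qed

text \<open>An antichain meets each of the \<open>r\<close> chains in at most one point.\<close>

lemma card_antichain_Int_chain_union:
  assumes "A \<in> antichains P k" "C \<in> chain_unions P r"
  shows "card (A \<inter> C) \<le> r"
proof -
  obtain c where c: "C = (\<Union>i<r. c i)" "\<forall>i<r. c i \<in> Chains P"
    using assms unfolding chain_unions_def by auto
  have one: "card (A \<inter> c i) \<le> 1" "finite (A \<inter> c i)" if "i < r" for i
  proof -
    have "x = y" if "x \<in> A \<inter> c i" "y \<in> A \<inter> c i" for x y
      using that c(2) \<open>i < r\<close> assms(1) unfolding antichains_def Chains_def by blast
    then have "A \<inter> c i = {} \<or> (\<exists>x. A \<inter> c i = {x})"
      by blast
    then show "card (A \<inter> c i) \<le> 1" "finite (A \<inter> c i)"
      by auto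
  qed
  have "A \<inter> C = (\<Union>i<r. A \<inter> c i)"
    using c by auto
  then have "card (A \<inter> C) \<le> (\<Sum>i<r. card (A \<inter> c i))"
    by (simp only: card_UN_le finite_lessThan)
  also have "\<dots> \<le> (\<Sum>i<r. 1)"
    using one by (intro sum_mono) auto
  finally show ?thesis by simp
qed

lemma antichains_subset: "\<lbrakk>A \<in> antichains P k; B \<subseteq> A; l \<le> card B\<rbrakk> \<Longrightarrow> B \<in> antichains P l"
  unfolding antichains_def by blast

text \<open>Following a permutation that only moves up in the order until it leaves the poset
  decomposes the moved points into chains, one for each exit.\<close>

lemma moved_points_chain_union:
  fixes P :: "'n::finite rel" and \<sigma> :: "'n + nat \<Rightarrow> 'n + nat"
  assumes poset: "partial_order_on UNIV P"
    and perm: "\<sigma> permutes range Inl \<union> Inr ` {..<r}"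
    and up: "\<And>v w. \<sigma> (Inl v) = Inl w \<Longrightarrow> (v, w) \<in> P"
  shows "{v. \<sigma> (Inl v) \<noteq> Inl v} \<in> chain_unions P r"
proof -
  note po = partial_order_onD[OF poset]
  let ?S = "range Inl \<union> Inr ` {..<r} :: ('n + nat) set"
  have inj: "inj \<sigma>" using perm by (rule permutes_inj)
  have injk: "inj (\<sigma> ^^ k)" for k
    using inj by (induction k) (auto intro: inj_compose)
  have above: "(v, w) \<in> P" if "\<forall>j<k. (\<sigma> ^^ j) (Inl v) \<in> range Inl" "(\<sigma> ^^ k) (Inl v) = Inl w"
    for k v w
    using that
  proof (induction k arbitrary: w)
    case 0
    then show ?case using po(1) by (auto simp: refl_on_def)
  next
    case (Suc k)
    then obtain u where u: "(\<sigma> ^^ k) (Inl v) = Inl u"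
      by blast
    with Suc have "(v, u) \<in> P" "(u, w) \<in> P"
      by (auto intro: up)
    then show ?case using po(2) by (meson transD)
  qed
  \<comment> \<open>Some positive power of \<open>\<sigma>\<close> is the identity. An orbit inside
    the poset would thus climb from \<open>v\<close> back to \<open>v\<close>, and antisymmetry
    would make \<open>v\<close> a fixed point.\<close>
  have exits: "\<exists>k. (\<sigma> ^^ k) (Inl v) \<notin> range Inl" if "\<sigma> (Inl v) \<noteq> Inl v" for v
  proof (rule ccontr)
    assume "\<nexists>k. (\<sigma> ^^ k) (Inl v) \<notin> range Inl"
    then have stay: "(\<sigma> ^^ k) (Inl v) \<in> range Inl" for k
      by blast
    have "permutation \<sigma>"
      unfolding permutation_permutes using perm by (intro exI[of _ ?S]) simp
    then obtain n where n: "\<sigma> ^^ n = id" "n > 0"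
      using permutation_is_nilpotent by blast
    obtain w where w: "\<sigma> (Inl v) = Inl w"
      using stay[of 1] by auto
    have "(\<sigma> ^^ (n - 1)) (Inl w) = Inl v"
      using fun_cong[OF funpow_Suc_right[where n = "n - 1" and f = \<sigma>], where x = "Inl v"] n w by simp
    moreover have "(\<sigma> ^^ j) (Inl w) \<in> range Inl" for j
      using stay[of "Suc j"] w by (simp add: funpow_Suc_right del: funpow.simps)
    ultimately have "(w, v) \<in> P"
      using above by blast
    moreover have "(v, w) \<in> P" using up w .
    ultimately have "v = w" using po(3) by (meson antisymD)
    with w that show False by simp
  qed
  \<comment> \<open>The time of the first exit from the poset; \<open>c i\<close> collects the moved
    points that leave through \<open>Inr i\<close>.\<close>
  define len where "len v = (LEAST k. (\<sigma> ^^ k) (Inl v) \<notin> range Inl)" for v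
  define c where "c i = {v. \<sigma> (Inl v) \<noteq> Inl v \<and> (\<sigma> ^^ len v) (Inl v) = Inr i}" for i
  have len: "(\<sigma> ^^ len v) (Inl v) \<notin> range Inl" "\<And>j. j < len v \<Longrightarrow> (\<sigma> ^^ j) (Inl v) \<in> range Inl"
    if "\<sigma> (Inl v) \<noteq> Inl v" for v
    using LeastI_ex[OF exits[OF that]] not_less_Least unfolding len_def by blast+
  \<comment> \<open>Cancelling the injective power of \<open>\<sigma>\<close> common to both orbits
    shows that the orbit of \<open>w\<close> passes through \<open>v\<close> before it
    exits.\<close>
  have chain: "(w, v) \<in> P" if v: "v \<in> c i" and w: "w \<in> c i" and le: "len v \<le> len w" for i v w
  proof -
    have "(\<sigma> ^^ len v) (Inl v) = (\<sigma> ^^ (len v + (len w - len v))) (Inl w)"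
      using v w le by (simp add: c_def)
    also have "\<dots> = (\<sigma> ^^ len v) ((\<sigma> ^^ (len w - len v)) (Inl w))"
      by (simp add: funpow_add)
    finally have eq: "(\<sigma> ^^ (len w - len v)) (Inl w) = Inl v"
      using injk by (metis injD)
    show ?thesis
      by (rule above[OF _ eq]) (use w len in \<open>auto simp: c_def\<close>)
  qed
  have "c i \<in> Chains P" for i
    unfolding Chains_def using chain[of _ i] nat_le_linear by blast
  moreover have "{v. \<sigma> (Inl v) \<noteq> Inl v} = (\<Union>i<r. c i)"
  proof
    show "(\<Union>i<r. c i) \<subseteq> {v. \<sigma> (Inl v) \<noteq> Inl v}"
      by (auto simp: c_def)
    show "{v. \<sigma> (Inl v) \<noteq> Inl v} \<subseteq> (\<Union>i<r. c i)"
    proof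
      fix v assume v: "v \<in> {v. \<sigma> (Inl v) \<noteq> Inl v}"
      have "(\<sigma> ^^ len v) (Inl v) \<in> ?S"
        using permutes_in_image[OF permutes_funpow[OF perm], where x = "Inl v"] by blast
      with len(1)[of v] v show "v \<in> (\<Union>i<r. c i)"
        by (auto simp: c_def)
    qed
  qed
  ultimately show ?thesis
    unfolding chain_unions_def by blast
qed

text \<open>The assignment problem on \<open>S\<close> encodes families of \<open>r\<close> chains: a fixed point of the
  permutation is an uncovered element and costs its multiplicity, any other element is sent to its
  successor in its chain, and the points \<open>Inr i\<close> link the end of a chain to the beginning of the
  next one. A dual solution assigns to \<open>v\<close> the interval from \<open>- b v\<close> to \<open>a v\<close>; intervals of
  comparable elements are disjoint, so the elements whose interval contains \<open>t\<close> form an antichain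
  \<open>T t\<close>.\<close>

lemma chain_union_duality:
  fixes P :: "'n::finite rel" and m :: "'n \<Rightarrow> nat"
  assumes poset: "partial_order_on UNIV P" and r: "r \<ge> 1"
    and s: "\<And>C. C \<in> chain_unions P r \<Longrightarrow> s \<le> sum m (- C)"
  shows "\<exists>As. set As \<subseteq> antichains P (r + 1) \<and> (\<forall>v. (\<Sum>A\<leftarrow>As. of_bool (v \<in> A)) \<le> m v) \<and>
           s \<le> (\<Sum>A\<leftarrow>As. card A - r)"
proof -
  note po = partial_order_onD[OF poset]
  define S :: "('n + nat) set" where "S = range Inl \<union> Inr ` {..<r}"
  \<comment> \<open>More than the cost of the identity, hence the cost of a forbidden step.\<close>
  define M where "M = int (sum m UNIV) + 1"
  define c :: "'n + nat \<Rightarrow> 'n + nat \<Rightarrow> int" where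
    "c x y = (case (x, y) of
        (Inl v, Inl w) \<Rightarrow> if v = w then int (m v) else if (v, w) \<in> P then 0 else M
      | _ \<Rightarrow> 0)" for x y
  have finX: "finite S" by (simp add: S_def)
  have sumX: "(\<Sum>x\<in>S. f x) = (\<Sum>v\<in>UNIV. f (Inl v)) + (\<Sum>i<r. f (Inr i))"
    for f :: "'n + nat \<Rightarrow> int"
    unfolding S_def by (subst sum.union_disjoint) (auto simp: sum.reindex)
  have "0 \<le> M"
    unfolding M_def by linarith
  then have c_nonneg: "0 \<le> c x y" for x y
    by (simp add: c_def split: sum.splits)
  obtain \<sigma> where perm: "\<sigma> permutes S"
    and opt: "\<And>\<tau>. \<tau> permutes S \<Longrightarrow> (\<Sum>x\<in>S. c x (\<sigma> x)) \<le> (\<Sum>x\<in>S. c x (\<tau> x))"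
  proof -
    have "id permutes S" by (rule permutes_id)
    then have "{\<tau>. \<tau> permutes S} \<noteq> {}" by blast
    from ex_min_if_finite[of "(\<lambda>\<tau>. \<Sum>x\<in>S. c x (\<tau> x)) ` {\<tau>. \<tau> permutes S}"] this finX
    obtain \<sigma> where "\<sigma> permutes S" "\<And>\<tau>. \<tau> permutes S \<Longrightarrow> \<not> (\<Sum>x\<in>S. c x (\<tau> x)) < (\<Sum>x\<in>S. c x (\<sigma> x))"
      by (auto simp: finite_permutations)
    then show ?thesis
      using that by (meson not_le)
  qed
  have "(\<Sum>x\<in>S. c x (\<sigma> x)) \<le> (\<Sum>x\<in>S. c x (id x))"
    by (rule opt[OF permutes_id])
  also have "\<dots> < M"
    by (simp add: sumX M_def c_def)
  finally have small: "(\<Sum>x\<in>S. c x (\<sigma> x)) < M" .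
  \<comment> \<open>All costs are nonnegative, so a single forbidden step would already cost more
    than the identity.\<close>
  have up: "(v, w) \<in> P" if "\<sigma> (Inl v) = Inl w" for v w
  proof (rule ccontr)
    assume "(v, w) \<notin> P"
    then have "c (Inl v) (\<sigma> (Inl v)) = M"
      using that po(1) by (auto simp: c_def refl_on_def)
    moreover have "c (Inl v) (\<sigma> (Inl v)) \<le> (\<Sum>x\<in>S. c x (\<sigma> x))"
      using c_nonneg finX by (intro member_le_sum) (auto simp: S_def)
    ultimately show False using small by simp
  qed
  let ?C = "{v. \<sigma> (Inl v) \<noteq> Inl v}"
  have C: "?C \<in> chain_unions P r"
    by (rule moved_points_chain_union[OF poset perm[unfolded S_def] up])
  \<comment> \<open>The fixed points are the elements outside the union of chains, and each of them
    costs its multiplicity.\<close>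
  have "int s \<le> (\<Sum>v\<in>- ?C. int (m v))"
    using s[OF C] by (simp flip: of_nat_sum)
  also have "\<dots> = (\<Sum>v\<in>- ?C. c (Inl v) (\<sigma> (Inl v)))"
    by (intro sum.cong) (auto simp: c_def)
  also have "\<dots> \<le> (\<Sum>v\<in>UNIV. c (Inl v) (\<sigma> (Inl v)))"
    by (intro sum_mono2) (auto simp: c_nonneg)
  also have "\<dots> \<le> (\<Sum>x\<in>S. c x (\<sigma> x))"
    by (auto simp: sumX c_nonneg intro: sum_nonneg)
  finally have s_le: "int s \<le> (\<Sum>x\<in>S. c x (\<sigma> x))" .
  from assignment_duality[where c = c, OF finX perm opt] obtain a b where
    ab: "\<And>x y. \<lbrakk>x \<in> S; y \<in> S\<rbrakk> \<Longrightarrow> a x + b y \<le> c x y"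
    and sum_ab: "(\<Sum>x\<in>S. a x + b x) = (\<Sum>x\<in>S. c x (\<sigma> x))"
    by blast
  \<comment> \<open>Pairs involving a point \<open>Inr i\<close> cost 0. Their dual constraints give
    \<open>L \<le> U\<close> and confine the interval of every \<open>v\<close> to the range from
    \<open>L\<close> to \<open>U\<close>.\<close>
  define L where "L = Max ((\<lambda>i. a (Inr i)) ` {..<r})"
  define U where "U = Min ((\<lambda>i. - b (Inr i)) ` {..<r})"
  have ne: "{..<r} \<noteq> {}" using r by (auto simp: lessThan_empty_iff)
  have L_ge: "a (Inr i) \<le> L" if "i < r" for i
    unfolding L_def using that by (intro Max_ge) auto
  have U_le: "U \<le> - b (Inr i)" if "i < r" for i
    unfolding U_def using that by (intro Min_le) auto
  have "L \<in> (\<lambda>i. a (Inr i)) ` {..<r}"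
    unfolding L_def using ne by (intro Max_in) auto
  then obtain i where i: "i < r" "L = a (Inr i)" by auto
  have "U \<in> (\<lambda>i. - b (Inr i)) ` {..<r}"
    unfolding U_def using ne by (intro Min_in) auto
  then obtain j where j: "j < r" "U = - b (Inr j)" by auto
  have inX: "Inl v \<in> S" "k < r \<Longrightarrow> Inr k \<in> S" for v k
    by (auto simp: S_def)
  have LU: "L \<le> U"
    using ab[of "Inr i" "Inr j"] i j inX by (simp add: c_def)
  have lo: "L \<le> - b (Inl v)" for v
    using ab[of "Inr i" "Inl v"] i inX by (simp add: c_def)
  have hi: "a (Inl v) \<le> U" for v
    using ab[of "Inl v" "Inr j"] j inX by (simp add: c_def)
  define T where "T t = {v. - b (Inl v) \<le> t \<and> t < a (Inl v)}" for t
  \<comment> \<open>A level with at most \<open>r\<close> elements adds nothing to the truncated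
    sum, and dropping it only lowers the covering numbers.\<close>
  define As where "As = filter (\<lambda>A. r < card A) (map T [L..U - 1])"
  have "T t \<in> antichains P 0" for t
  proof -
    have "(v, w) \<notin> P" if "v \<in> T t" "w \<in> T t" "v \<noteq> w" for v w
      using ab[of "Inl v" "Inl w"] inX that by (auto simp: c_def T_def)
    then show ?thesis by (auto simp: antichains_def)
  qed
  then have "set As \<subseteq> antichains P (r + 1)"
    unfolding As_def antichains_def by auto
  moreover have "(\<Sum>A\<leftarrow>As. of_bool (v \<in> A)) \<le> m v" for v
  proof -
    have "(\<Sum>A\<leftarrow>As. of_bool (v \<in> A)) = (\<Sum>t\<leftarrow>[L..U - 1]. if r < card (T t) then of_bool (v \<in> T t) else 0 :: nat)"
      unfolding As_def by (simp add: sum_list_map_filter' o_def)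
    also have "\<dots> \<le> (\<Sum>t\<leftarrow>[L..U - 1]. of_bool (v \<in> T t))"
      by (intro sum_list_mono) auto
    also have "\<dots> = card ({L..U - 1} \<inter> {t. v \<in> T t})"
      by (simp add: sum_list_distinct_conv_sum_set)
    also have "\<dots> \<le> card {- b (Inl v)..<a (Inl v)}"
      by (intro card_mono) (auto simp: T_def)
    also have "\<dots> \<le> m v"
      using ab[of "Inl v" "Inl v"] inX by (simp add: c_def)
    finally show ?thesis .
  qed
  moreover have "int s \<le> int (\<Sum>A\<leftarrow>As. card A - r)"
  proof -
    have "(\<Sum>x\<in>S. a x + b x) = (\<Sum>v\<in>UNIV. a (Inl v) + b (Inl v)) + (\<Sum>i<r. a (Inr i) + b (Inr i))"
      by (rule sumX)
    \<comment> \<open>Only an inequality, since \<open>a (Inl v) + b (Inl v)\<close> may be negative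
      when the interval is empty.\<close>
    also have "(\<Sum>v\<in>UNIV. a (Inl v) + b (Inl v)) \<le> (\<Sum>v\<in>UNIV. \<Sum>t\<in>{L..U - 1}. of_bool (v \<in> T t))"
    proof (rule sum_mono)
      fix v
      have "{L..U - 1} \<inter> {t. v \<in> T t} = {- b (Inl v)..<a (Inl v)}"
        using lo[of v] hi[of v] by (auto simp: T_def)
      then show "a (Inl v) + b (Inl v) \<le> (\<Sum>t\<in>{L..U - 1}. of_bool (v \<in> T t))"
        by simp
    qed
    also have "\<dots> = (\<Sum>t\<in>{L..U - 1}. int (card (T t)))"
      by (subst sum.swap) simp
    \<comment> \<open>The \<open>r\<close> auxiliary points contribute at most \<open>- r\<close>
      for each of the \<open>U - L\<close> levels, which accounts for the subtraction of
      \<open>r\<close> from the size of each antichain.\<close>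
    also have "(\<Sum>i<r. a (Inr i) + b (Inr i)) \<le> (\<Sum>i<r. L - U)"
      using L_ge U_le by (intro sum_mono) fastforce
    also have "\<dots> = (\<Sum>t\<in>{L..U - 1}. - int r)"
      using LU by (simp add: algebra_simps)
    finally have "(\<Sum>x\<in>S. a x + b x) \<le> (\<Sum>t\<in>{L..U - 1}. int (card (T t)) - int r)"
      by (simp add: sum_subtractf)
    also have "\<dots> \<le> (\<Sum>t\<in>{L..U - 1}. int (card (T t) - r))"
      by (intro sum_mono) simp
    also have "\<dots> = int (\<Sum>t\<leftarrow>[L..U - 1]. card (T t) - r)"
      by (simp add: sum_list_distinct_conv_sum_set)
    also have "(\<Sum>t\<leftarrow>[L..U - 1]. card (T t) - r) = (\<Sum>A\<leftarrow>As. card A - r)"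
      unfolding As_def by (simp add: sum_list_map_filter' o_def)
        (rule arg_cong[where f = sum_list], simp)
    finally show ?thesis
      using s_le sum_ab by simp
  qed
  ultimately show ?thesis
    by (intro exI[of _ As]) simp
qed

text \<open>The generators require the sum to be exactly \<open>s\<close>. Leading antichains are
  dropped while the rest still reaches \<open>s\<close>; the first indispensable one is then
  shrunk.\<close>

lemma trim_antichains:
  assumes "set As \<subseteq> antichains P (r + 1)" "s \<le> (\<Sum>A\<leftarrow>As. card A - r)"
  shows "\<exists>Bs. set Bs \<subseteq> antichains P (r + 1) \<and>
           (\<forall>v. (\<Sum>A\<leftarrow>Bs. of_bool (v \<in> A)) \<le> (\<Sum>A\<leftarrow>As. of_bool (v \<in> A) :: nat)) \<and>
           (\<Sum>A\<leftarrow>Bs. card A - r) = s"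
  using assms
proof (induction As)
  case Nil
  then show ?case by (intro exI[of _ "[]"]) simp
next
  case (Cons A As)
  show ?case
  proof (cases "s \<le> (\<Sum>A\<leftarrow>As. card A - r)")
    case True
    with Cons obtain Bs where Bs: "set Bs \<subseteq> antichains P (r + 1)" "(\<Sum>A\<leftarrow>Bs. card A - r) = s"
        "\<And>v. (\<Sum>A\<leftarrow>Bs. of_bool (v \<in> A)) \<le> (\<Sum>A\<leftarrow>As. of_bool (v \<in> A) :: nat)"
      by auto
    then show ?thesis
      by (intro exI[of _ Bs]) (auto intro: trans_le_add2 le_SucI)
  next
    case False
    \<comment> \<open>The deficit left by the remaining antichains. It is positive, so a subset of
      size \<open>r + d\<close> still has at least \<open>r + 1\<close> elements.\<close>
    define d where "d = s - (\<Sum>A\<leftarrow>As. card A - r)"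
    have d: "0 < d" "r + d \<le> card A" "s = d + (\<Sum>A\<leftarrow>As. card A - r)"
      using False Cons.prems by (auto simp: d_def)
    obtain B where B: "B \<subseteq> A" "card B = r + d"
      using obtain_subset_with_card_n[OF d(2)] by blast
    then have "B \<in> antichains P (r + 1)"
      using antichains_subset[of A P "r + 1" B "r + 1"] Cons.prems d by simp
    then show ?thesis
      using B d Cons.prems by (intro exI[of _ "B # As"]) auto
  qed
qed


section \<open>Ideals of a commutative ring\<close>

text \<open>Negatives come from multiplication by -1, so closure under sums and multiples
  suffices.\<close>

lemma ideal_type_iff:
  "ideal I (ring_of_type_algebra :: 'a::comm_ring_1 ring) \<longleftrightarrow>
     0 \<in> I \<and> (\<forall>a\<in>I. \<forall>b\<in>I. a + b \<in> I) \<and> (\<forall>a\<in>I. \<forall>x. x * a \<in> I)"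
proof
  let ?R = "ring_of_type_algebra :: 'a ring"
  assume "ideal I ?R"
  then interpret ideal I ?R .
  show "0 \<in> I \<and> (\<forall>a\<in>I. \<forall>b\<in>I. a + b \<in> I) \<and> (\<forall>a\<in>I. \<forall>x. x * a \<in> I)"
    using additive_subgroup.zero_closed[OF is_additive_subgroup]
      additive_subgroup.a_closed[OF is_additive_subgroup] I_l_closed by (simp add: ring_of_type_algebra_def)
next
  let ?R = "ring_of_type_algebra :: 'a ring"
  assume *: "0 \<in> I \<and> (\<forall>a\<in>I. \<forall>b\<in>I. a + b \<in> I) \<and> (\<forall>a\<in>I. \<forall>x. x * a \<in> I)"
  interpret R: ring ?R by (rule ring_from_type_algebra)
  have neg: "\<ominus>\<^bsub>?R\<^esub> a = - a" for a
    by (rule R.minus_equality) (simp_all add: ring_of_type_algebra_def)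
  have "- a \<in> I" if "a \<in> I" for a
    using * that by (metis mult_minus1)
  then have "subgroup I (add_monoid ?R)"
    using * neg by (intro R.add.subgroupI) (auto simp: ring_of_type_algebra_def a_inv_def)
  then show "ideal I ?R"
    using * by (intro idealI R.ring_axioms) (auto simp: ring_of_type_algebra_def mult.commute)
qed

lemma primeideal_type_iff:
  "primeideal I (ring_of_type_algebra :: 'a::comm_ring_1 ring) \<longleftrightarrow>
     ideal I (ring_of_type_algebra :: 'a ring) \<and> 1 \<notin> I \<and> (\<forall>a b. a * b \<in> I \<longrightarrow> a \<in> I \<or> b \<in> I)"
  (is "?L \<longleftrightarrow> ?R")
proof
  assume ?L
  then interpret primeideal I "ring_of_type_algebra :: 'a ring" .
  show ?R
    using I_prime is_ideal one_imp_carrier I_notcarr by (auto simp: ring_of_type_algebra_def)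
next
  assume ?R
  then show ?L
    by (intro primeidealI cring_from_type_algebra) (auto simp: ring_of_type_algebra_def)
qed

lemma ideal_typeD:
  assumes "ideal I (ring_of_type_algebra :: 'a::comm_ring_1 ring)"
  shows "0 \<in> I" "a \<in> I \<Longrightarrow> b \<in> I \<Longrightarrow> a + b \<in> I" "a \<in> I \<Longrightarrow> x * a \<in> I" "a \<in> I \<Longrightarrow> a * x \<in> I"
    "(\<And>i. i \<in> A \<Longrightarrow> g i \<in> I) \<Longrightarrow> sum g A \<in> I"
proof -
  note * = assms[unfolded ideal_type_iff]
  show "0 \<in> I" "a \<in> I \<Longrightarrow> b \<in> I \<Longrightarrow> a + b \<in> I" "a \<in> I \<Longrightarrow> x * a \<in> I"
    using * by auto
  show "a \<in> I \<Longrightarrow> a * x \<in> I"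
    using * by (metis mult.commute)
  show "(\<And>i. i \<in> A \<Longrightarrow> g i \<in> I) \<Longrightarrow> sum g A \<in> I"
    using * by (induction A rule: infinite_finite_induct) auto
qed

lemma ideal_generated_ideal: "ideal (ideal_generated S) (ring_of_type_algebra :: 'a::comm_ring_1 ring)"
  by (rule ring.genideal_ideal[OF ring_from_type_algebra]) (simp add: ring_of_type_algebra_def)

lemma ideal_generated_base: "a \<in> S \<Longrightarrow> a \<in> ideal_generated (S :: 'a::comm_ring_1 set)"
  by (auto simp: genideal_def)

lemma ideal_generated_least:
  "\<lbrakk>ideal I (ring_of_type_algebra :: 'a::comm_ring_1 ring); S \<subseteq> I\<rbrakk> \<Longrightarrow> ideal_generated S \<subseteq> I"
  by (auto simp: genideal_def)

lemma ideal_mult_prod: "\<lbrakk>a \<in> I; b \<in> J\<rbrakk> \<Longrightarrow> a * b \<in> ideal_mult I (J :: 'a::comm_ring_1 set)"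
  using ideal_prod.prod[of a I b J ring_of_type_algebra] by (simp add: ring_of_type_algebra_def)

lemma ideal_mult_least:
  assumes "ideal K (ring_of_type_algebra :: 'a::comm_ring_1 ring)"
    and "\<And>a b. \<lbrakk>a \<in> I; b \<in> J\<rbrakk> \<Longrightarrow> a * b \<in> K"
  shows "ideal_mult I J \<subseteq> K"
proof
  fix x assume "x \<in> ideal_mult I J"
  then show "x \<in> K"
    by (induction rule: ideal_prod.induct)
      (use assms ideal_typeD(2) in \<open>auto simp: ring_of_type_algebra_def\<close>)
qed

lemma ideal_mult_ideal:
  assumes "ideal I (ring_of_type_algebra :: 'a::comm_ring_1 ring)" "ideal J ring_of_type_algebra"
  shows "ideal (ideal_mult I J) (ring_of_type_algebra :: 'a ring)"
  by (rule ring.ideal_prod_is_ideal[OF ring_from_type_algebra assms])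

lemma one_ideals_set: "\<one>\<^bsub>ideals_set ring_of_type_algebra\<^esub> = (UNIV :: 'a::comm_ring_1 set)"
  by (simp add: ideals_set_def ring_of_type_algebra_def)

lemma ideal_power_Suc: "ideal_power I (Suc n) = ideal_mult (ideal_power I n) (I :: 'a::comm_ring_1 set)"
  by (simp add: nat_pow_def ideals_set_def)

lemma ideal_power_ideal:
  assumes "ideal I (ring_of_type_algebra :: 'a::comm_ring_1 ring)"
  shows "ideal (ideal_power I n) (ring_of_type_algebra :: 'a ring)"
proof (induction n)
  case 0
  show ?case by (simp add: one_ideals_set ideal_type_iff)
next
  case (Suc n)
  then show ?case
    unfolding ideal_power_Suc by (intro ideal_mult_ideal assms)
qed

text \<open>Clearing denominators in \<open>f/1 = a/t\<close> multiplies \<open>f\<close> into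
  \<open>K\<close>; conversely \<open>f/1\<close> equals \<open>(u * f)/u\<close>.\<close>

lemma fraction_mem_localized_ideal_iff:
  assumes S: "1 \<in> S" "\<And>s t. \<lbrakk>s \<in> S; t \<in> S\<rbrakk> \<Longrightarrow> s * t \<in> S"
    and K: "ideal K (ring_of_type_algebra :: 'a::comm_ring_1 ring)"
  shows "fraction S f 1 \<in> localized_ideal S K \<longleftrightarrow> (\<exists>u\<in>S. u * f \<in> K)"
proof
  assume "fraction S f 1 \<in> localized_ideal S K"
  then obtain a t where at: "fraction S f 1 = fraction S a t" "a \<in> K" "t \<in> S"
    unfolding localized_ideal_def by blast
  have "(f, 1) \<in> fraction S f 1"
    unfolding fraction_def localization_rel_def using S(1) by auto
  then obtain u where u: "u \<in> S" "u * (a - t * f) = 0"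
    unfolding at(1) unfolding fraction_def localization_rel_def by auto
  then have "(u * t) * f = u * a"
    by (simp add: algebra_simps)
  then show "\<exists>u\<in>S. u * f \<in> K"
    using u(1) at ideal_typeD(3)[OF K] S(2) by metis
next
  assume "\<exists>u\<in>S. u * f \<in> K"
  then obtain u where u: "u \<in> S" "u * f \<in> K" by blast
  \<comment> \<open>The two conditions differ by the factor \<open>u\<close>, which lies in
    \<open>S\<close>, so both fractions are the same class.\<close>
  have "(\<exists>w\<in>S. w * (v * f - b) = 0) \<longleftrightarrow> (\<exists>w\<in>S. w * (v * (u * f) - u * b) = 0)" for b v
  proof
    assume "\<exists>w\<in>S. w * (v * f - b) = 0"
    then obtain w where "w \<in> S" "w * (v * f - b) = 0" by blast
    moreover have "w * (v * (u * f) - u * b) = u * (w * (v * f - b))"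
      by (simp add: algebra_simps)
    ultimately show "\<exists>w\<in>S. w * (v * (u * f) - u * b) = 0" by auto
  next
    assume "\<exists>w\<in>S. w * (v * (u * f) - u * b) = 0"
    then obtain w where "w \<in> S" "w * (v * (u * f) - u * b) = 0" by blast
    moreover have "w * (v * (u * f) - u * b) = (w * u) * (v * f - b)"
      by (simp add: algebra_simps)
    ultimately show "\<exists>w\<in>S. w * (v * f - b) = 0" using S(2) u(1) by metis
  qed
  then have "fraction S f 1 = fraction S (u * f) u"
    unfolding fraction_def localization_rel_def using S(1) u(1) by (auto simp: Image_def)
  then show "fraction S f 1 \<in> localized_ideal S K"
    unfolding localized_ideal_def using u by blast
qed

section \<open>Symbolic powers of intersections of monomial primes\<close>

abbreviation monomial :: "('v \<Rightarrow>\<^sub>0 nat) \<Rightarrow> ('v, 'k::comm_ring_1) mpoly" where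
  "monomial m \<equiv> Poly_Mapping.single m 1"

lemma mpoly_eq_sum_single:
  "f = (\<Sum>m\<in>Poly_Mapping.keys f. Poly_Mapping.single m (Poly_Mapping.lookup f m))"
  by (rule poly_mapping_eqI) (auto simp: lookup_sum lookup_single when_def in_keys_iff)

lemma single_eq_Const_mult: "Poly_Mapping.single m c = Const c * monomial m"
  by (simp add: Const_def mult_single)

lemma mem_ideal_of_monomials:
  assumes "ideal I (ring_of_type_algebra :: ('v, 'k::comm_ring_1) mpoly ring)"
    and "\<And>m. m \<in> Poly_Mapping.keys f \<Longrightarrow> monomial m \<in> I"
  shows "f \<in> I"
  by (subst mpoly_eq_sum_single, intro ideal_typeD(5)[OF assms(1)], subst single_eq_Const_mult)
    (intro ideal_typeD(3)[OF assms(1)] assms(2))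

lemma lookup_mult_sum:
  fixes f g :: "('a::comm_monoid_add) \<Rightarrow>\<^sub>0 ('k::comm_ring_1)"
  shows "Poly_Mapping.lookup (f * g) k =
     (\<Sum>m\<in>Poly_Mapping.keys f. \<Sum>n\<in>Poly_Mapping.keys g.
        if m + n = k then Poly_Mapping.lookup f m * Poly_Mapping.lookup g n else 0)"
proof -
  have "f * g = (\<Sum>m\<in>Poly_Mapping.keys f. \<Sum>n\<in>Poly_Mapping.keys g.
      Poly_Mapping.single (m + n) (Poly_Mapping.lookup f m * Poly_Mapping.lookup g n))"
    unfolding mult_single[symmetric] sum_product[symmetric] mpoly_eq_sum_single[symmetric] ..
  then show ?thesis
    by (simp add: lookup_sum lookup_single when_def)
qed

section \<open>Orders of vanishing along coordinate subspaces\<close>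

definition deg_in :: "'v set \<Rightarrow> ('v \<Rightarrow>\<^sub>0 nat) \<Rightarrow> nat" where
  "deg_in A m = (\<Sum>i\<in>A. Poly_Mapping.lookup m i)"

lemma deg_in_add [simp]: "deg_in A (m + n) = deg_in A m + deg_in A n"
  by (simp add: deg_in_def lookup_add sum.distrib)

lemma deg_in_0 [simp]: "deg_in A 0 = 0"
  by (simp add: deg_in_def)

lemma deg_in_single [simp]: "deg_in A (Poly_Mapping.single i c) = (if i \<in> A then c else 0)"
  for A :: "'v::finite set"
  by (simp add: deg_in_def lookup_single when_def sum.delta)

lemma deg_in_mono: "A \<subseteq> B \<Longrightarrow> deg_in A m \<le> deg_in B m" for A :: "'v::finite set"
  unfolding deg_in_def by (rule sum_mono2) auto

lemma deg_in_eq_0_iff: "deg_in A m = 0 \<longleftrightarrow> Poly_Mapping.keys m \<inter> A = {}" for A :: "'v::finite set"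
  by (auto simp: deg_in_def in_keys_iff)

lemma deg_in_ge_1_iff: "1 \<le> deg_in A m \<longleftrightarrow> Poly_Mapping.keys m \<inter> A \<noteq> {}" for A :: "'v::finite set"
  using deg_in_eq_0_iff[of A m] by linarith

text \<open>Vanishing to order at least \<open>s\<close> along each of the coordinate subspaces
  \<open>x\<^sub>i = 0\<close> (\<open>i \<in> A\<close>).\<close>

definition vanishing :: "'v set set \<Rightarrow> nat \<Rightarrow> ('v, 'k::comm_ring_1) mpoly set" where
  "vanishing \<A> s = {f. \<forall>m\<in>Poly_Mapping.keys f. \<forall>A\<in>\<A>. s \<le> deg_in A m}"

lemma vanishing_ideal: "ideal (vanishing \<A> s) (ring_of_type_algebra :: ('v, 'k::comm_ring_1) mpoly ring)"
  unfolding ideal_type_iff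
proof (intro conjI ballI allI)
  show "0 \<in> vanishing \<A> s" by (simp add: vanishing_def)
  show "f + g \<in> vanishing \<A> s" if "f \<in> vanishing \<A> s" "g \<in> vanishing \<A> s"
    for f g :: "('v, 'k) mpoly"
    using that keys_add[of f g] by (auto simp: vanishing_def)
  show "g * f \<in> vanishing \<A> s" if "f \<in> vanishing \<A> s" for f g :: "('v, 'k) mpoly"
    using that keys_mult[of g f] by (fastforce simp: vanishing_def intro: trans_le_add2)
qed

lemma vanishing_mult:
  assumes "f \<in> vanishing \<A> s" "g \<in> vanishing \<A> t"
  shows "f * g \<in> vanishing \<A> (s + t)"
  using assms keys_mult[of f g] by (fastforce simp: vanishing_def intro: add_mono)

lemma monomial_in_vanishing_iff:
  "(monomial m :: ('v, 'k::comm_ring_1) mpoly) \<in> vanishing \<A> s \<longleftrightarrow> (\<forall>A\<in>\<A>. s \<le> deg_in A m)"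
  by (simp add: vanishing_def)

text \<open>Membership in \<open>vanishing\<close> is a condition on each term separately, so it is
  a monomial ideal and inclusions can be tested on monomials.\<close>

lemma vanishing_subset_iff_monomials:
  assumes "ideal I (ring_of_type_algebra :: ('v, 'k::comm_ring_1) mpoly ring)"
  shows "vanishing \<A> s \<subseteq> I \<longleftrightarrow> (\<forall>m. (\<forall>A\<in>\<A>. s \<le> deg_in A m) \<longrightarrow> monomial m \<in> I)"
proof
  show "vanishing \<A> s \<subseteq> I \<Longrightarrow> \<forall>m. (\<forall>A\<in>\<A>. s \<le> deg_in A m) \<longrightarrow> monomial m \<in> I"
    using monomial_in_vanishing_iff by blast
  show "\<forall>m. (\<forall>A\<in>\<A>. s \<le> deg_in A m) \<longrightarrow> monomial m \<in> I \<Longrightarrow> vanishing \<A> s \<subseteq> I"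
    using mem_ideal_of_monomials[OF assms] by (auto simp: vanishing_def)
qed

text \<open>A lexicographic choice of minimal monomials: they play the role of leading monomials without
  requiring an order on the variables.\<close>

lemma exists_extreme_pair:
  fixes K L :: "('v::finite \<Rightarrow>\<^sub>0 nat) set"
  assumes "finite K" "K \<noteq> {}" "finite L" "L \<noteq> {}"
  shows "\<exists>m0\<in>K. \<exists>n0\<in>L. \<forall>m\<in>K. \<forall>n\<in>L. m + n = m0 + n0 \<longrightarrow> m = m0 \<and> n = n0"
proof -
  have "\<exists>m0\<in>K. \<exists>n0\<in>L. \<forall>m\<in>K. \<forall>n\<in>L. m + n = m0 + n0 \<longrightarrow>
      (\<forall>i\<in>V. Poly_Mapping.lookup m i = Poly_Mapping.lookup m0 i \<and>
              Poly_Mapping.lookup n i = Poly_Mapping.lookup n0 i)"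
    if "finite V" for V :: "'v set"
    using that assms
  proof (induction V arbitrary: K L rule: finite_induct)
    case empty
    then show ?case by auto
  next
    case (insert i V)
    \<comment> \<open>Minimise coordinate \<open>i\<close> first and choose the remaining
      coordinates among the minimisers.\<close>
    define mins where "mins M = {m\<in>M. \<forall>m'\<in>M. Poly_Mapping.lookup m i \<le> Poly_Mapping.lookup m' i}"
      for M :: "('v \<Rightarrow>\<^sub>0 nat) set"
    have mins: "mins M \<noteq> {}" "finite (mins M)" if "finite M" "M \<noteq> {}" for M
    proof -
      from ex_has_least_nat[of "\<lambda>m. m \<in> M" _ "\<lambda>m. Poly_Mapping.lookup m i"] that(2)
      show "mins M \<noteq> {}" unfolding mins_def by blast
      show "finite (mins M)" using that by (simp add: mins_def)
    qed
    obtain m0 n0 where mn0: "m0 \<in> mins K" "n0 \<in> mins L"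
      and uniq: "\<And>m n j. \<lbrakk>m \<in> mins K; n \<in> mins L; m + n = m0 + n0; j \<in> V\<rbrakk> \<Longrightarrow>
         Poly_Mapping.lookup m j = Poly_Mapping.lookup m0 j \<and>
         Poly_Mapping.lookup n j = Poly_Mapping.lookup n0 j"
      using insert.IH[of "mins K" "mins L"] mins insert.prems by metis
    show ?case
    proof (rule bexI[of _ m0], rule bexI[of _ n0], intro ballI impI)
      fix m n j
      assume mn: "m \<in> K" "n \<in> L" "m + n = m0 + n0" and j: "j \<in> insert i V"
      \<comment> \<open>Both summands are bounded below by those of the chosen pair, so equal sums
        force equality in each.\<close>
      have "Poly_Mapping.lookup m i + Poly_Mapping.lookup n i = Poly_Mapping.lookup m0 i + Poly_Mapping.lookup n0 i"
        using mn(3) by (metis lookup_add)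
      moreover have "Poly_Mapping.lookup m0 i \<le> Poly_Mapping.lookup m i"
        "Poly_Mapping.lookup n0 i \<le> Poly_Mapping.lookup n i"
        using mn mn0 by (auto simp: mins_def)
      ultimately have eq: "Poly_Mapping.lookup m i = Poly_Mapping.lookup m0 i"
        "Poly_Mapping.lookup n i = Poly_Mapping.lookup n0 i"
        by linarith+
      then have "m \<in> mins K" "n \<in> mins L"
        using mn mn0 by (auto simp: mins_def)
      with uniq mn j eq show "Poly_Mapping.lookup m j = Poly_Mapping.lookup m0 j \<and>
          Poly_Mapping.lookup n j = Poly_Mapping.lookup n0 j"
        by blast
    qed (use mn0 in \<open>auto simp: mins_def\<close>)
  qed
  from this[of UNIV] show ?thesis
    by (metis UNIV_I finite_class.finite_UNIV poly_mapping_eqI)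
qed

text \<open>If \<open>f\<close> had too small an order along \<open>A\<close>, an extreme term of
  its part of lowest order times an extreme term of the order-zero part of \<open>g\<close> could
  not cancel in \<open>g * f\<close>.\<close>

lemma vanishing_primary:
  fixes f g :: "('v::finite, 'k::idom) mpoly"
  assumes fg: "g * f \<in> vanishing {A} s" and g: "g \<notin> vanishing {A} 1"
  shows "f \<in> vanishing {A} s"
proof (rule ccontr)
  assume "f \<notin> vanishing {A} s"
  then obtain m1 where m1: "m1 \<in> Poly_Mapping.keys f" "deg_in A m1 < s"
    by (auto simp: vanishing_def)
  from ex_has_least_nat[of "\<lambda>m. m \<in> Poly_Mapping.keys f" m1 "deg_in A"] m1(1)
  obtain m2 where m2: "m2 \<in> Poly_Mapping.keys f"
      "\<And>m. m \<in> Poly_Mapping.keys f \<Longrightarrow> deg_in A m2 \<le> deg_in A m"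
    by blast
  define K where "K = {m \<in> Poly_Mapping.keys f. deg_in A m = deg_in A m2}"
  define L where "L = {n \<in> Poly_Mapping.keys g. deg_in A n = 0}"
  have "K \<noteq> {}" using m2(1) by (auto simp: K_def)
  moreover have "L \<noteq> {}" using g by (force simp: vanishing_def L_def)
  moreover have "finite K" "finite L" by (simp_all add: K_def L_def)
  ultimately obtain m0 n0 where mn0: "m0 \<in> K" "n0 \<in> L"
    and uniq: "\<And>m n. \<lbrakk>m \<in> K; n \<in> L; m + n = m0 + n0\<rbrakk> \<Longrightarrow> m = m0 \<and> n = n0"
    using exists_extreme_pair by metis
  \<comment> \<open>Another pair with the same sum has the same total order along \<open>A\<close>;
    minimality of \<open>m2\<close> then puts it into \<open>K\<close> and \<open>L\<close>, where
    the extreme pair is unique.\<close>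
  have only: "n + m = n0 + m0 \<longleftrightarrow> n = n0 \<and> m = m0"
    if "n \<in> Poly_Mapping.keys g" "m \<in> Poly_Mapping.keys f" for n m
  proof
    assume eq: "n + m = n0 + m0"
    then have "deg_in A n + deg_in A m = deg_in A m2"
      using mn0 by (metis (mono_tags, lifting) K_def L_def deg_in_add mem_Collect_eq add_0)
    with m2(2)[OF that(2)] have "m \<in> K" "n \<in> L"
      using that by (auto simp: K_def L_def)
    with uniq eq show "n = n0 \<and> m = m0" by (simp add: add.commute)
  qed simp
  have in_keys: "n0 \<in> Poly_Mapping.keys g" "m0 \<in> Poly_Mapping.keys f"
    using mn0 by (auto simp: K_def L_def)
  have "Poly_Mapping.lookup (g * f) (n0 + m0) =
      (\<Sum>n\<in>Poly_Mapping.keys g. \<Sum>m\<in>Poly_Mapping.keys f.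
         if n = n0 \<and> m = m0 then Poly_Mapping.lookup g n * Poly_Mapping.lookup f m else 0)"
    unfolding lookup_mult_sum using only by (intro sum.cong) auto
  also have "\<dots> = (\<Sum>n\<in>Poly_Mapping.keys g. if n = n0 then
      (\<Sum>m\<in>Poly_Mapping.keys f. if m = m0 then Poly_Mapping.lookup g n * Poly_Mapping.lookup f m else 0) else 0)"
    by (intro sum.cong) auto
  also have "\<dots> = Poly_Mapping.lookup g n0 * Poly_Mapping.lookup f m0"
    using in_keys by (simp add: sum.delta)
  also have "\<dots> \<noteq> 0"
    using in_keys by (simp add: in_keys_iff)
  finally have "n0 + m0 \<in> Poly_Mapping.keys (g * f)"
    by (simp add: in_keys_iff)
  with fg have "s \<le> deg_in A (n0 + m0)"
    by (simp add: vanishing_def del: deg_in_add)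
  moreover have "deg_in A (n0 + m0) = deg_in A m2"
    using mn0 by (simp add: K_def L_def)
  ultimately show False
    using m1 m2 by fastforce
qed

lemma vanishing_prime:
  "primeideal (vanishing {A} 1) (ring_of_type_algebra :: ('v::finite, 'k::idom) mpoly ring)"
  unfolding primeideal_type_iff
proof (intro conjI allI impI)
  show "1 \<notin> vanishing {A} 1" by (simp add: vanishing_def)
  show "f \<in> vanishing {A} 1 \<or> g \<in> vanishing {A} 1" if "f * g \<in> vanishing {A} 1"
    for f g :: "('v, 'k) mpoly"
    using vanishing_primary[OF that] by blast
qed (rule vanishing_ideal)

lemma vanishing_singleton_mono: "A \<subseteq> B \<Longrightarrow> vanishing {A} s \<subseteq> (vanishing {B} s :: ('v::finite, 'k::comm_ring_1) mpoly set)"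
  unfolding vanishing_def using deg_in_mono[of A B] by (auto intro: order_trans)

lemma vanishing_singleton_subset_iff:
  "vanishing {A} 1 \<subseteq> (vanishing {B} 1 :: ('v::finite, 'k::comm_ring_1) mpoly set) \<longleftrightarrow> A \<subseteq> B"
proof
  assume sub: "vanishing {A} 1 \<subseteq> (vanishing {B} 1 :: ('v, 'k) mpoly set)"
  show "A \<subseteq> B"
  proof
    fix i assume "i \<in> A"
    then have "(monomial (Poly_Mapping.single i 1) :: ('v, 'k) mpoly) \<in> vanishing {A} 1"
      by (simp add: vanishing_def)
    with sub have "(monomial (Poly_Mapping.single i 1) :: ('v, 'k) mpoly) \<in> vanishing {B} 1"
      by blast
    then show "i \<in> B"
      by (simp add: monomial_in_vanishing_iff split: if_splits)
  qed
qed (rule vanishing_singleton_mono)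

section \<open>Factorisations of monomials\<close>

lemma monomial_add: "monomial (m + n) = monomial m * (monomial n :: ('v, 'k::comm_ring_1) mpoly)"
  by (simp add: mult_single)

lemma monomial_sum: "monomial (\<Sum>i\<in>A. g i) = (\<Prod>i\<in>A. monomial (g i) :: ('v, 'k::comm_ring_1) mpoly)"
  by (induction A rule: infinite_finite_induct) (auto simp: monomial_add)

lemma monomial_eq_mult_Var:
  assumes "i \<in> Poly_Mapping.keys m"
  shows "\<exists>n. (monomial m :: ('v, 'k::comm_ring_1) mpoly) = monomial n * Var i"
proof -
  have "m = (m - Poly_Mapping.single i 1) + Poly_Mapping.single i 1"
    using assms by (intro poly_mapping_eqI) (auto simp: lookup_add lookup_minus lookup_single when_def in_keys_iff)
  then show ?thesis
    unfolding Var_def by (metis monomial_add)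
qed

text \<open>The exponent vector of \<open>squarefree_monomial A\<close>, not itself a
  polynomial.\<close>

definition set_monomial :: "'v set \<Rightarrow> 'v \<Rightarrow>\<^sub>0 nat" where
  "set_monomial A = (\<Sum>i\<in>A. Poly_Mapping.single i 1)"

lemma lookup_set_monomial: "finite A \<Longrightarrow> Poly_Mapping.lookup (set_monomial A) i = of_bool (i \<in> A)"
  by (simp add: set_monomial_def lookup_sum lookup_single when_def sum.delta)

lemma keys_set_monomial: "finite A \<Longrightarrow> Poly_Mapping.keys (set_monomial A) = A"
  by (auto simp: in_keys_iff lookup_set_monomial)

lemma deg_in_set_monomial: "deg_in B (set_monomial A) = card (A \<inter> B)" for A B :: "'v::finite set"
  by (simp add: deg_in_def lookup_set_monomial Int_commute)

lemma squarefree_monomial_eq: "squarefree_monomial A = (monomial (set_monomial A) :: ('v, 'k::comm_ring_1) mpoly)"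
  by (simp add: squarefree_monomial_def set_monomial_def monomial_sum Var_def)

lemma monomial_dvd:
  assumes "\<And>i. Poly_Mapping.lookup n i \<le> Poly_Mapping.lookup m i"
  shows "(monomial m :: ('v, 'k::comm_ring_1) mpoly) = monomial (m - n) * monomial n"
proof -
  have "m = (m - n) + n"
    using assms by (intro poly_mapping_eqI) (simp add: lookup_add lookup_minus)
  then show ?thesis by (metis monomial_add)
qed

text \<open>Otherwise the set \<open>T\<close> of variables outside \<open>Q\<close> meets every
  \<open>A\<close>. Then the product over \<open>T\<close> vanishes on all components and lies in
  \<open>Q\<close>, although none of its factors does, against primality.\<close>

lemma prime_contains_vanishing:
  fixes Q :: "('v::finite, 'k::comm_ring_1) mpoly set"
  assumes Q: "primeideal Q ring_of_type_algebra" and sub: "vanishing \<A> 1 \<subseteq> Q"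
  shows "\<exists>A\<in>\<A>. vanishing {A} 1 \<subseteq> Q"
proof (rule ccontr)
  assume none: "\<not> (\<exists>A\<in>\<A>. vanishing {A} 1 \<subseteq> Q)"
  note prime = Q[unfolded primeideal_type_iff]
  note idl = ideal_typeD[OF conjunct1[OF prime]]
  define T where "T = {i. Var i \<notin> Q}"
  have "A \<inter> T \<noteq> {}" if "A \<in> \<A>" for A
  proof
    assume "A \<inter> T = {}"
    have "monomial m \<in> Q" if "1 \<le> deg_in A m" for m
    proof -
      obtain i where i: "i \<in> Poly_Mapping.keys m" "i \<in> A"
        using \<open>1 \<le> deg_in A m\<close> unfolding deg_in_ge_1_iff by blast
      then have "Var i \<in> Q"
        using \<open>A \<inter> T = {}\<close> by (auto simp: T_def)
      with monomial_eq_mult_Var[OF i(1)] show ?thesis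
        by (metis idl(3))
    qed
    then have "vanishing {A} 1 \<subseteq> Q"
      by (subst vanishing_subset_iff_monomials) (use prime in auto)
    with none that show False by blast
  qed
  then have "(monomial (set_monomial T) :: ('v, 'k) mpoly) \<in> vanishing \<A> 1"
    unfolding monomial_in_vanishing_iff deg_in_ge_1_iff by (auto simp: keys_set_monomial)
  then have "(\<Prod>i\<in>T. Var i) \<in> Q"
    using sub by (auto simp: squarefree_monomial_eq[symmetric] squarefree_monomial_def)
  moreover have "(\<Prod>i\<in>U. Var i) \<notin> Q" if "U \<subseteq> T" for U
    using finite[of U] that
    by (induction U rule: finite_induct) (use prime in \<open>auto simp: T_def\<close>)
  ultimately show False by blast
qed

text \<open>Every prime above the intersection contains some \<open>vanishing {A} 1\<close>, and
  inclusion of these primes is inclusion of the index sets. Only the inclusion-minimal sets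
  survive.\<close>

lemma minimal_primes_vanishing:
  fixes \<A> :: "'v::finite set set"
  defines "\<M> \<equiv> {B\<in>\<A>. \<forall>A\<in>\<A>. A \<subseteq> B \<longrightarrow> A = B}"
  shows "minimal_primes (vanishing \<A> 1 :: ('v, 'k::idom) mpoly set) = (\<lambda>B. vanishing {B} 1) ` \<M>"
    (is "?L = ?R")
proof
  have sub: "vanishing \<A> 1 \<subseteq> (vanishing {A} 1 :: ('v, 'k) mpoly set)" if "A \<in> \<A>" for A
    using that by (auto simp: vanishing_def)
  have eq_iff: "(vanishing {A} 1 :: ('v, 'k) mpoly set) = vanishing {B} 1 \<longleftrightarrow> A = B" for A B
    by (metis vanishing_singleton_subset_iff order_refl subset_antisym)
  show "?L \<subseteq> ?R"
  proof
    fix Q :: "('v, 'k) mpoly set"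
    assume "Q \<in> ?L"
    then have Q: "primeideal Q ring_of_type_algebra" "vanishing \<A> 1 \<subseteq> Q"
      and min: "\<And>Q'. \<lbrakk>primeideal Q' ring_of_type_algebra; vanishing \<A> 1 \<subseteq> Q'; Q' \<subseteq> Q\<rbrakk> \<Longrightarrow> Q' = Q"
      unfolding minimal_primes_def by auto
    obtain B where B: "B \<in> \<A>" "vanishing {B} 1 \<subseteq> Q"
      using prime_contains_vanishing[OF Q] by blast
    then have Q_eq: "Q = vanishing {B} 1"
      using min[OF vanishing_prime sub] by metis
    have "A = B" if "A \<in> \<A>" "A \<subseteq> B" for A
      using min[OF vanishing_prime sub, of A] that Q_eq eq_iff vanishing_singleton_mono by metis
    with B Q_eq show "Q \<in> ?R" by (auto simp: \<M>_def)
  qed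
  show "?R \<subseteq> ?L"
  proof
    fix Q :: "('v, 'k) mpoly set"
    assume "Q \<in> ?R"
    then obtain B where B: "Q = vanishing {B} 1" "B \<in> \<A>" "\<And>A. \<lbrakk>A \<in> \<A>; A \<subseteq> B\<rbrakk> \<Longrightarrow> A = B"
      by (auto simp: \<M>_def)
    have "Q' = Q" if Q': "primeideal Q' ring_of_type_algebra" "vanishing \<A> 1 \<subseteq> Q'" "Q' \<subseteq> Q" for Q'
    proof -
      obtain A where A: "A \<in> \<A>" "vanishing {A} 1 \<subseteq> Q'"
        using prime_contains_vanishing[OF Q'(1,2)] by blast
      then have "(vanishing {A} 1 :: ('v, 'k) mpoly set) \<subseteq> vanishing {B} 1"
        using Q'(3) B(1) by blast
      then have "A = B"
        using A B vanishing_singleton_subset_iff by metis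
      with A B Q' show ?thesis by blast
    qed
    moreover have "primeideal Q ring_of_type_algebra"
      unfolding B(1) by (rule vanishing_prime)
    moreover have "vanishing \<A> 1 \<subseteq> Q"
      unfolding B(1) by (rule sub[OF B(2)])
    ultimately show "Q \<in> ?L"
      unfolding minimal_primes_def by simp
  qed
qed

lemma ideal_power_vanishing_subset:
  "ideal_power (vanishing \<A> 1) s \<subseteq> (vanishing \<A> s :: ('v, 'k::comm_ring_1) mpoly set)"
proof (induction s)
  case (Suc s)
  show ?case
    unfolding ideal_power_Suc
  proof (rule ideal_mult_least[OF vanishing_ideal])
    fix f g :: "('v, 'k) mpoly"
    assume "f \<in> ideal_power (vanishing \<A> 1) s" "g \<in> vanishing \<A> 1"
    then show "f * g \<in> vanishing \<A> (Suc s)"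
      using vanishing_mult[of f \<A> s g 1] Suc.IH by auto
  qed
qed (simp add: vanishing_def)

text \<open>Locally at a minimal prime the symbolic and ordinary powers agree: the variables outside \<open>B\<close>
  are units there.\<close>

lemma monomial_mult_in_ideal_power:
  fixes \<A> :: "'v::finite set set"
  assumes B: "B \<in> \<A>" "\<And>A. \<lbrakk>A \<in> \<A>; A \<subseteq> B\<rbrakk> \<Longrightarrow> A = B" and m: "s \<le> deg_in B m"
  shows "(monomial (set_monomial (- B)) :: ('v, 'k::comm_ring_1) mpoly) ^ s * monomial m
           \<in> ideal_power (vanishing \<A> 1) s"
  using m
proof (induction s arbitrary: m)
  case 0
  then show ?case by (simp add: one_ideals_set)
next
  case (Suc s)
  then have "Poly_Mapping.keys m \<inter> B \<noteq> {}"
    using deg_in_ge_1_iff[of B m] by simp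
  then obtain i where i: "i \<in> Poly_Mapping.keys m" "i \<in> B" by blast
  define n where "n = m - Poly_Mapping.single i 1"
  have m_eq: "m = n + Poly_Mapping.single i 1"
    using i unfolding n_def
    by (intro poly_mapping_eqI) (auto simp: lookup_add lookup_minus lookup_single when_def in_keys_iff)
  have keys: "Poly_Mapping.keys (set_monomial (- B) + Poly_Mapping.single i 1) = insert i (- B)"
    by (auto simp: in_keys_iff lookup_add lookup_set_monomial lookup_single when_def)
  \<comment> \<open>A member of \<open>\<A>\<close> missing both \<open>i\<close> and
    \<open>- B\<close> would lie in \<open>B\<close>, hence equal \<open>B\<close> by minimality,
    yet \<open>B\<close> contains \<open>i\<close>.\<close>
  have "insert i (- B) \<inter> A \<noteq> {}" if "A \<in> \<A>" for A
    using B(2)[OF that] i by blast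
  then have "(monomial (set_monomial (- B) + Poly_Mapping.single i 1) :: ('v, 'k) mpoly) \<in> vanishing \<A> 1"
    unfolding monomial_in_vanishing_iff deg_in_ge_1_iff keys by auto
  moreover have "(monomial (set_monomial (- B)) :: ('v, 'k) mpoly) ^ s * monomial n \<in> ideal_power (vanishing \<A> 1) s"
    by (rule Suc.IH) (use Suc.prems i in \<open>simp add: m_eq\<close>)
  ultimately have "(monomial (set_monomial (- B)) ^ s * monomial n) * (monomial (set_monomial (- B) + Poly_Mapping.single i 1) :: ('v, 'k) mpoly)
      \<in> ideal_power (vanishing \<A> 1) (Suc s)"
    unfolding ideal_power_Suc by (intro ideal_mult_prod)
  then show ?case
    unfolding m_eq by (simp add: monomial_add algebra_simps)
qed

text \<open>Denominators lie outside all minimal primes, so they can be cancelled at each minimal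
  \<open>B\<close> by \<open>vanishing_primary\<close>. Conversely, one denominator, a sum of
  monomials in the variables outside the minimal sets, moves every \<open>f\<close> into the
  ordinary power.\<close>

theorem symbolic_power_vanishing:
  fixes \<A> :: "'v::finite set set"
  assumes "\<A> \<noteq> {}" "1 \<le> s"
  shows "symbolic_power (vanishing \<A> 1) s = (vanishing \<A> s :: ('v, 'k::idom) mpoly set)"
proof -
  define \<M> where "\<M> = {B\<in>\<A>. \<forall>A\<in>\<A>. A \<subseteq> B \<longrightarrow> A = B}"
  define S :: "('v, 'k) mpoly set" where "S = - \<Union>(minimal_primes (vanishing \<A> 1))"
  have S_eq: "S = {u. \<forall>B\<in>\<M>. u \<notin> vanishing {B} 1}"
    unfolding S_def minimal_primes_vanishing \<M>_def by blast
  have below: "\<exists>B\<in>\<M>. B \<subseteq> A" if "A \<in> \<A>" for A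
    using finite_has_minimal2[of \<A> A] that by (auto simp: \<M>_def)
  have idl: "ideal (ideal_power (vanishing \<A> 1) s) (ring_of_type_algebra :: ('v, 'k) mpoly ring)"
    by (rule ideal_power_ideal[OF vanishing_ideal])
  have "f \<in> symbolic_power (vanishing \<A> 1) s \<longleftrightarrow>
      (\<exists>u\<in>S. u * f \<in> ideal_power (vanishing \<A> 1) s)" for f :: "('v, 'k) mpoly"
    unfolding symbolic_power_def Let_def S_def[symmetric] mem_Collect_eq
  proof (rule fraction_mem_localized_ideal_iff)
    show "1 \<in> S" by (simp add: S_eq vanishing_def)
    show "u * v \<in> S" if "u \<in> S" "v \<in> S" for u v
      using that vanishing_prime unfolding S_eq primeideal_type_iff by blast
  qed (intro ideal_power_ideal vanishing_ideal)
  moreover have "f \<in> vanishing \<A> s" if "u \<in> S" "u * f \<in> ideal_power (vanishing \<A> 1) s"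
    for u f :: "('v, 'k) mpoly"
  proof -
    have "s \<le> deg_in A m" if "A \<in> \<A>" "m \<in> Poly_Mapping.keys f" for A m
    proof -
      obtain B where B: "B \<in> \<M>" "B \<subseteq> A" using below \<open>A \<in> \<A>\<close> by blast
      have "u * f \<in> vanishing \<A> s"
        using ideal_power_vanishing_subset \<open>u * f \<in> _\<close> by blast
      then have "u * f \<in> vanishing {B} s"
        using B by (auto simp: vanishing_def \<M>_def)
      then have "f \<in> vanishing {B} s"
        using \<open>u \<in> S\<close> B by (intro vanishing_primary[of u f]) (auto simp: S_eq)
      then show ?thesis
        using vanishing_singleton_mono[OF B(2)] that by (auto simp: vanishing_def)
    qed
    then show ?thesis by (auto simp: vanishing_def)
  qed
  moreover have "\<exists>u\<in>S. u * f \<in> ideal_power (vanishing \<A> 1) s" if f: "f \<in> vanishing \<A> s"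
    for f :: "('v, 'k) mpoly"
  proof -
    define n where "n B = (\<Sum>k<s. set_monomial (- B))" for B :: "'v set"
    have lookup_n: "Poly_Mapping.lookup (n B) i = (if i \<in> B then 0 else s)" for B i
      by (simp add: n_def lookup_sum lookup_set_monomial)
    \<comment> \<open>Since \<open>s\<close> is positive, distinct sets give distinct exponents, so
      the terms of \<open>u\<close> below do not merge.\<close>
    have inj: "n A = n B \<longleftrightarrow> A = B" for A B
    proof
      assume "n A = n B"
      then have "i \<in> A \<longleftrightarrow> i \<in> B" for i
        using lookup_n[of A i] lookup_n[of B i] assms(2) by (auto split: if_splits)
      then show "A = B" by blast
    qed simp
    have power: "(monomial (n B) :: ('v, 'k) mpoly) = monomial (set_monomial (- B)) ^ s" for B
      by (simp add: n_def monomial_sum)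
    \<comment> \<open>The term belonging to \<open>B\<close> involves no variable of
      \<open>B\<close>, so \<open>u\<close> avoids all minimal primes at once.\<close>
    define u :: "('v, 'k) mpoly" where "u = (\<Sum>B\<in>\<M>. monomial (n B))"
    have "u \<notin> vanishing {B} 1" if "B \<in> \<M>" for B
    proof -
      have "Poly_Mapping.lookup u (n B) = 1"
        using that by (simp add: u_def lookup_sum lookup_single when_def inj sum.delta)
      then have "n B \<in> Poly_Mapping.keys u" by (simp add: in_keys_iff)
      moreover have "deg_in B (n B) = 0" by (simp add: deg_in_def lookup_n)
      ultimately show ?thesis by (force simp: vanishing_def)
    qed
    moreover have "u * f \<in> ideal_power (vanishing \<A> 1) s"
    proof -
      have "monomial (n B) * f \<in> ideal_power (vanishing \<A> 1) s" if B: "B \<in> \<M>" for B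
      proof -
        have mem: "monomial (n B) * monomial m \<in> (ideal_power (vanishing \<A> 1) s :: ('v, 'k) mpoly set)"
          if "m \<in> Poly_Mapping.keys f" for m
          unfolding power using B f that
          by (intro monomial_mult_in_ideal_power) (auto simp: \<M>_def vanishing_def)
        have eq: "monomial (n B) * f = (\<Sum>m\<in>Poly_Mapping.keys f.
            Const (Poly_Mapping.lookup f m) * (monomial (n B) * monomial m))"
          by (subst mpoly_eq_sum_single[of f])
            (simp add: sum_distrib_left single_eq_Const_mult[of _ "Poly_Mapping.lookup f _"] mult.left_commute)
        show ?thesis
          unfolding eq
          by (intro ideal_typeD(5)[OF idl] ideal_typeD(3)[OF idl] mem)
      qed
      then show ?thesis
        unfolding u_def sum_distrib_right
        by (intro ideal_typeD(5)[OF idl])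
    qed
    ultimately show ?thesis by (auto simp: S_eq)
  qed
  ultimately show ?thesis by blast
qed


section \<open>Joins of intersections of monomial primes\<close>

definition monom_eval :: "('v \<Rightarrow> ('w, 'k) mpoly) \<Rightarrow> ('v \<Rightarrow>\<^sub>0 nat) \<Rightarrow> ('w, 'k::comm_ring_1) mpoly" where
  "monom_eval g m = (\<Prod>i\<in>Poly_Mapping.keys m. g i ^ Poly_Mapping.lookup m i)"

definition subst_vars :: "('v \<Rightarrow> ('w, 'k) mpoly) \<Rightarrow> ('v, 'k) mpoly \<Rightarrow> ('w, 'k::comm_ring_1) mpoly" where
  "subst_vars g f = (\<Sum>m\<in>Poly_Mapping.keys f. Const (Poly_Mapping.lookup f m) * monom_eval g m)"

lemma rename_eq_subst_vars: "rename h = subst_vars (\<lambda>i. Var (h i))"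
  by (simp add: fun_eq_iff rename_def subst_vars_def monom_eval_def)

lemma Const_0 [simp]: "Const 0 = 0"
  and Const_1 [simp]: "Const 1 = 1"
  and Const_add: "Const (a + b) = Const a + Const b"
  and Const_mult: "Const (a * b) = Const a * Const b"
  by (simp_all add: Const_def single_add mult_single)

lemma monom_eval_superset:
  assumes "finite V" "Poly_Mapping.keys m \<subseteq> V"
  shows "monom_eval g m = (\<Prod>i\<in>V. g i ^ Poly_Mapping.lookup m i)"
  unfolding monom_eval_def using assms
  by (intro prod.mono_neutral_left) (auto simp: in_keys_iff)

lemma monom_eval_add: "monom_eval g (m + n) = monom_eval g m * monom_eval g n"
  using keys_add[of m n]
  by (simp add: monom_eval_superset[where V = "Poly_Mapping.keys m \<union> Poly_Mapping.keys n"]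
      lookup_add power_add prod.distrib)

lemma subst_vars_0 [simp]: "subst_vars g 0 = 0"
  by (simp add: subst_vars_def)

lemma subst_vars_add: "subst_vars g (p + q) = subst_vars g p + subst_vars g q"
  unfolding subst_vars_def
  by (rule setsum_keys_plus_distrib[where f = "\<lambda>m c. Const c * monom_eval g m"])
    (simp_all add: Const_add distrib_right)

lemma subst_vars_sum: "subst_vars g (\<Sum>i\<in>A. p i) = (\<Sum>i\<in>A. subst_vars g (p i))"
  by (induction A rule: infinite_finite_induct) (simp_all add: subst_vars_add)

lemma subst_vars_single: "subst_vars g (Poly_Mapping.single m c) = Const c * monom_eval g m"
  by (simp add: subst_vars_def)

lemma subst_vars_mult: "subst_vars g (p * q) = subst_vars g p * subst_vars g q"
proof -
  have "p * q = (\<Sum>m\<in>Poly_Mapping.keys p. \<Sum>n\<in>Poly_Mapping.keys q.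
      Poly_Mapping.single (m + n) (Poly_Mapping.lookup p m * Poly_Mapping.lookup q n))"
    unfolding mult_single[symmetric] sum_product[symmetric] mpoly_eq_sum_single[symmetric] ..
  then show ?thesis
    by (simp add: subst_vars_sum subst_vars_single)
      (simp add: subst_vars_def sum_product Const_mult monom_eval_add algebra_simps)
qed

lemma subst_vars_1 [simp]: "subst_vars g 1 = 1"
  using subst_vars_single[of g 0 1] by (simp add: monom_eval_def)

lemma subst_vars_Const [simp]: "subst_vars g (Const c) = Const c"
  using subst_vars_single[of g 0 c] by (simp add: monom_eval_def Const_def)

lemma subst_vars_Var [simp]: "subst_vars g (Var i) = g i"
  by (simp add: Var_def subst_vars_single monom_eval_def)

lemma subst_vars_prod: "subst_vars g (\<Prod>i\<in>A. p i) = (\<Prod>i\<in>A. subst_vars g (p i))"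
  by (induction A rule: infinite_finite_induct) (simp_all add: subst_vars_mult)

lemma subst_vars_power: "subst_vars g (p ^ n) = subst_vars g p ^ n"
  by (induction n) (simp_all add: subst_vars_mult)

lemma subst_vars_diff: "subst_vars g (p - q) = subst_vars g p - subst_vars g q"
  using subst_vars_add[of g "p - q" q] by (simp add: algebra_simps)

lemma subst_vars_rename: "subst_vars g (rename h p) = subst_vars (\<lambda>i. g (h i)) p"
  unfolding rename_def
  by (simp add: subst_vars_sum subst_vars_mult subst_vars_prod subst_vars_power)
    (simp add: subst_vars_def monom_eval_def)

lemma subst_vars_kernel: "ideal {p. subst_vars g p = 0} (ring_of_type_algebra :: ('v, 'k::comm_ring_1) mpoly ring)"
  unfolding ideal_type_iff by (simp add: subst_vars_add subst_vars_mult)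

text \<open>Substituting this restricts a polynomial to the coordinate subspace on which the
  variables outside \<open>E\<close> are zero.\<close>

definition restrict_var :: "'v set \<Rightarrow> 'v \<Rightarrow> ('v, 'k::comm_ring_1) mpoly" where
  "restrict_var E i = (if i \<in> E then Var i else 0)"

lemma monom_eval_Var: "monom_eval Var m = monomial m"
proof -
  have "Var i ^ n = (monomial (Poly_Mapping.single i n) :: ('a, 'b) mpoly)" for i n
    by (induction n) (simp_all add: Var_def mult_single single_add[symmetric])
  then have "monom_eval Var m = (monomial (\<Sum>i\<in>Poly_Mapping.keys m. Poly_Mapping.single i (Poly_Mapping.lookup m i)) :: ('a, 'b) mpoly)"
    by (simp add: monom_eval_def monomial_sum)
  also have "(\<Sum>i\<in>Poly_Mapping.keys m. Poly_Mapping.single i (Poly_Mapping.lookup m i)) = m"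
    by (rule mpoly_eq_sum_single[symmetric])
  finally show ?thesis .
qed

lemma monom_eval_restrict_var:
  "monom_eval (restrict_var E) m = (if Poly_Mapping.keys m \<subseteq> E then monomial m else 0)"
proof (cases "Poly_Mapping.keys m \<subseteq> E")
  case True
  then have "monom_eval (restrict_var E) m = monom_eval Var m"
    unfolding monom_eval_def by (intro prod.cong) (auto simp: restrict_var_def)
  with True show ?thesis by (simp add: monom_eval_Var)
next
  case False
  then obtain i where "i \<in> Poly_Mapping.keys m" "i \<notin> E" by blast
  then have "monom_eval (restrict_var E) m = 0"
    unfolding monom_eval_def
    by (intro prod_zero) (auto simp: restrict_var_def in_keys_iff power_0_left intro!: bexI[of _ i])
  with False show ?thesis by simp
qed

text \<open>The substitution deletes exactly the terms involving a variable outside \<open>E\<close>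
  and keeps the others unchanged.\<close>

lemma subst_restrict_var_eq_0_iff:
  fixes f :: "('v::finite, 'k::comm_ring_1) mpoly"
  shows "subst_vars (restrict_var E) f = 0 \<longleftrightarrow> f \<in> vanishing {- E} 1"
proof -
  have eq: "Const c * (if b then monomial m else 0) = Poly_Mapping.single m (if b then c else 0)"
    for c :: 'k and m :: "'v \<Rightarrow>\<^sub>0 nat" and b
    by (simp add: single_eq_Const_mult[symmetric])
  have "Poly_Mapping.lookup (subst_vars (restrict_var E) f) m =
      (if Poly_Mapping.keys m \<subseteq> E then Poly_Mapping.lookup f m else 0)" for m
    unfolding subst_vars_def monom_eval_restrict_var eq
    by (auto simp: lookup_sum lookup_single when_def sum.delta in_keys_iff)
  then have "subst_vars (restrict_var E) f = 0 \<longleftrightarrow>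
      (\<forall>m. Poly_Mapping.keys m \<subseteq> E \<longrightarrow> Poly_Mapping.lookup f m = 0)"
    by (auto simp: poly_mapping_eq_iff fun_eq_iff)
  also have "\<dots> \<longleftrightarrow> (\<forall>m\<in>Poly_Mapping.keys f. Poly_Mapping.keys m \<inter> - E \<noteq> {})"
    by (auto simp: in_keys_iff)
  finally show ?thesis
    unfolding vanishing_def deg_in_ge_1_iff by simp
qed

lemma rename_squarefree_monomial: "rename h (squarefree_monomial A) = (\<Prod>i\<in>A. Var (h i))"
  by (simp add: rename_eq_subst_vars squarefree_monomial_def subst_vars_prod)

text \<open>Factors congruent modulo \<open>K\<close> have congruent products, by exchanging one
  factor at a time.\<close>

lemma prod_diff_in_ideal:
  fixes f g :: "'i \<Rightarrow> 'a::comm_ring_1"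
  assumes K: "ideal K (ring_of_type_algebra :: 'a ring)" and diff: "\<And>i. f i - g i \<in> K"
    and g: "(\<Prod>i\<in>A. g i) \<in> K"
  shows "(\<Prod>i\<in>A. f i) \<in> K"
proof -
  note idl = ideal_typeD[OF K]
  have "(\<Prod>i\<in>A. f i) - (\<Prod>i\<in>A. g i) \<in> K"
  proof (induction A rule: infinite_finite_induct)
    case (insert i A)
    have "(\<Prod>i\<in>insert i A. f i) - (\<Prod>i\<in>insert i A. g i) =
        f i * ((\<Prod>i\<in>A. f i) - (\<Prod>i\<in>A. g i)) + (f i - g i) * (\<Prod>i\<in>A. g i)"
      using insert.hyps by (simp add: algebra_simps)
    with insert.IH diff idl show ?case by metis
  qed (simp_all add: idl)
  from idl(2)[OF this g] show ?thesis by simp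
qed

text \<open>To see that the join vanishes on the subspace of \<open>A \<inter> B\<close>, substitute \<open>y\<^sub>i = x\<^sub>i\<close> for
  \<open>i \<notin> A\<close>, \<open>z\<^sub>i = x\<^sub>i\<close> for \<open>i \<in> A - B\<close> and zero otherwise; at most one of \<open>y\<^sub>i\<close>,
  \<open>z\<^sub>i\<close> is nonzero, so the characteristic plays no role. Conversely, \<open>\<Prod>(y\<^sub>i + z\<^sub>i)\<close> expands into
  monomials each of which lies in one of the two ideals.\<close>

theorem join_vanishing:
  fixes \<A> \<B> :: "'v::finite set set"
  shows "join_ideal (vanishing \<A> 1) (vanishing \<B> 1) =
           (vanishing {A \<inter> B |A B. A \<in> \<A> \<and> B \<in> \<B>} 1 :: ('v, 'k::comm_ring_1) mpoly set)"
proof -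
  define G :: "('v xyz, 'k) mpoly set" where
    "G = rename y_var ` vanishing \<A> 1 \<union> rename z_var ` vanishing \<B> 1 \<union>
         {Var (x_var i) - Var (y_var i) - Var (z_var i) |i. True}"
  have K: "ideal (ideal_generated G) (ring_of_type_algebra :: ('v xyz, 'k) mpoly ring)"
    by (rule ideal_generated_ideal)
  note idl = ideal_typeD[OF K]
  have join: "join_ideal (vanishing \<A> 1) (vanishing \<B> 1) = {f. rename x_var f \<in> ideal_generated G}"
    by (simp add: join_ideal_def G_def)
  have "f \<in> vanishing {A \<inter> B} 1"
    if f: "rename x_var f \<in> ideal_generated G" and A: "A \<in> \<A>" and B: "B \<in> \<B>"
    for f :: "('v, 'k) mpoly" and A B
  proof -
    \<comment> \<open>\<open>- A\<close> and \<open>A - B\<close> are disjoint with union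
      \<open>- (A \<inter> B)\<close>, which sends the linear generators to zero.\<close>
    define \<phi> :: "'v xyz \<Rightarrow> ('v, 'k) mpoly" where
      "\<phi> v = (case v of x_var i \<Rightarrow> restrict_var (- (A \<inter> B)) i | y_var i \<Rightarrow> restrict_var (- A) i
             | z_var i \<Rightarrow> restrict_var (A - B) i)" for v
    have "subst_vars \<phi> p = 0" if "p \<in> G" for p
      using that unfolding G_def
    proof (elim UnE imageE CollectE exE conjE)
      fix q :: "('v, 'k) mpoly" assume "p = rename y_var q" "q \<in> vanishing \<A> 1"
      moreover from this have "q \<in> vanishing {A} 1" using A by (auto simp: vanishing_def)
      ultimately show ?thesis
        using subst_restrict_var_eq_0_iff[of "- A" q] by (simp add: subst_vars_rename \<phi>_def)
    next
      fix q :: "('v, 'k) mpoly" assume "p = rename z_var q" "q \<in> vanishing \<B> 1"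
      moreover from this have "q \<in> vanishing {B} 1" using B by (auto simp: vanishing_def)
      moreover have "vanishing {B} 1 \<subseteq> (vanishing {- (A - B)} 1 :: ('v, 'k) mpoly set)"
        by (rule vanishing_singleton_mono) blast
      ultimately show ?thesis
        using subst_restrict_var_eq_0_iff[of "A - B" q] by (auto simp: subst_vars_rename \<phi>_def)
    next
      fix i assume "p = Var (x_var i) - Var (y_var i) - Var (z_var i)"
      then show ?thesis
        by (auto simp: subst_vars_diff \<phi>_def restrict_var_def)
    qed
    then have "ideal_generated G \<subseteq> {p. subst_vars \<phi> p = 0}"
      by (intro ideal_generated_least subst_vars_kernel) blast
    with f have "subst_vars (restrict_var (- (A \<inter> B))) f = 0"
      by (auto simp: subst_vars_rename \<phi>_def)
    then show ?thesis
      unfolding subst_restrict_var_eq_0_iff by simp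
  qed
  note component = this
  have le: "join_ideal (vanishing \<A> 1) (vanishing \<B> 1) \<subseteq>
      (vanishing {A \<inter> B |A B. A \<in> \<A> \<and> B \<in> \<B>} 1 :: ('v, 'k) mpoly set)"
  proof
    fix f :: "('v, 'k) mpoly"
    assume "f \<in> join_ideal (vanishing \<A> 1) (vanishing \<B> 1)"
    then have "rename x_var f \<in> ideal_generated G" unfolding join by simp
    note component[OF this]
    then show "f \<in> vanishing {A \<inter> B |A B. A \<in> \<A> \<and> B \<in> \<B>} 1"
      unfolding vanishing_def by auto
  qed
  have "(squarefree_monomial S :: ('v, 'k) mpoly) \<in> join_ideal (vanishing \<A> 1) (vanishing \<B> 1)"
    if S: "\<And>A B. \<lbrakk>A \<in> \<A>; B \<in> \<B>\<rbrakk> \<Longrightarrow> S \<inter> (A \<inter> B) \<noteq> {}" for S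
  proof -
    have sq: "(squarefree_monomial T :: ('v, 'k) mpoly) \<in> vanishing \<C> 1 \<longleftrightarrow> (\<forall>C\<in>\<C>. T \<inter> C \<noteq> {})" for T \<C>
      unfolding squarefree_monomial_eq monomial_in_vanishing_iff deg_in_ge_1_iff
      by (simp add: keys_set_monomial)
    \<comment> \<open>If \<open>T\<close> misses some \<open>A\<close>, then \<open>S - T\<close>
      contains \<open>S \<inter> A\<close> and so meets every \<open>B\<close>.\<close>
    have "(\<Prod>i\<in>T. Var (y_var i)) * (\<Prod>i\<in>S - T. Var (z_var i)) \<in> ideal_generated G" if "T \<subseteq> S" for T
    proof (cases "\<forall>A\<in>\<A>. T \<inter> A \<noteq> {}")
      case True
      then have "(\<Prod>i\<in>T. Var (y_var i)) \<in> G"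
        using sq[of T \<A>] unfolding G_def rename_squarefree_monomial[symmetric] by blast
      then show ?thesis
        by (intro idl(4) ideal_generated_base)
    next
      case False
      then obtain A where A: "A \<in> \<A>" "T \<inter> A = {}" by blast
      have "\<forall>B\<in>\<B>. (S - T) \<inter> B \<noteq> {}"
        using S[OF A(1)] A(2) by blast
      then have "(\<Prod>i\<in>S - T. Var (z_var i)) \<in> G"
        using sq[of "S - T" \<B>] unfolding G_def rename_squarefree_monomial[symmetric] by blast
      then show ?thesis
        by (intro idl(3) ideal_generated_base)
    qed
    then have "(\<Prod>i\<in>S. Var (y_var i) + Var (z_var i)) \<in> ideal_generated G"
      unfolding prod_add[OF finite] by (intro idl(5)) blast
    moreover have "Var (x_var i) - (Var (y_var i) + Var (z_var i)) \<in> ideal_generated G" for i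
      unfolding diff_diff_eq[symmetric] by (rule ideal_generated_base) (auto simp: G_def)
    ultimately have "(\<Prod>i\<in>S. Var (x_var i)) \<in> ideal_generated G"
      by (intro prod_diff_in_ideal[OF K, of "\<lambda>i. Var (x_var i)"])
    then show ?thesis
      unfolding join by (simp add: rename_squarefree_monomial)
  qed
  note sq = this
  have idl_join: "ideal (join_ideal (vanishing \<A> 1) (vanishing \<B> 1)) (ring_of_type_algebra :: ('v, 'k) mpoly ring)"
    unfolding join ideal_type_iff using idl
    by (simp add: rename_eq_subst_vars subst_vars_add subst_vars_mult)
  have "vanishing {A \<inter> B |A B. A \<in> \<A> \<and> B \<in> \<B>} 1 \<subseteq>
      (join_ideal (vanishing \<A> 1) (vanishing \<B> 1) :: ('v, 'k) mpoly set)"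
    unfolding vanishing_subset_iff_monomials[OF idl_join]
  proof (intro allI impI)
    fix m :: "'v \<Rightarrow>\<^sub>0 nat"
    assume m: "\<forall>C\<in>{A \<inter> B |A B. A \<in> \<A> \<and> B \<in> \<B>}. 1 \<le> deg_in C m"
    then have "Poly_Mapping.keys m \<inter> (A \<inter> B) \<noteq> {}" if "A \<in> \<A>" "B \<in> \<B>" for A B
      using that unfolding deg_in_ge_1_iff by blast
    \<comment> \<open>A monomial is a multiple of the product of the variables in its support, which
      meets the same sets.\<close>
    from sq[of "Poly_Mapping.keys m", OF this]
    have "monomial (m - set_monomial (Poly_Mapping.keys m)) * squarefree_monomial (Poly_Mapping.keys m)
        \<in> (join_ideal (vanishing \<A> 1) (vanishing \<B> 1) :: ('v, 'k) mpoly set)"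
      by (intro ideal_typeD(3)[OF idl_join])
    moreover have "monomial m = monomial (m - set_monomial (Poly_Mapping.keys m)) *
        (squarefree_monomial (Poly_Mapping.keys m) :: ('v, 'k) mpoly)"
      unfolding squarefree_monomial_eq
      by (rule monomial_dvd) (auto simp: lookup_set_monomial in_keys_iff)
    ultimately show "(monomial m :: ('v, 'k) mpoly) \<in> join_ideal (vanishing \<A> 1) (vanishing \<B> 1)"
      by simp
  qed
  with le show ?thesis by blast
qed

section \<open>Antichain ideals\<close>

text \<open>\<open>chain_covers P r\<close> indexes the components of the \<open>r\<close>-th secant variety: its members
  are the sets of variables that vanish on them.\<close>

definition chain_covers :: "'v rel \<Rightarrow> nat \<Rightarrow> 'v set set" where
  "chain_covers P r = {- C |C. C \<in> chain_unions P r}"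

text \<open>On both sides the monomials are those whose support is not a chain: such a support
  contains an incomparable pair, and it meets the complement of every chain.\<close>

lemma incomparability_ideal_eq_vanishing:
  fixes P :: "'v::finite rel"
  assumes "refl P"
  shows "incomparability_ideal P = (vanishing (chain_covers P 1) 1 :: ('v, 'k::comm_ring_1) mpoly set)"
proof
  let ?G = "{Var i * Var j |i j. (i, j) \<notin> P \<and> (j, i) \<notin> P} :: ('v, 'k) mpoly set"
  have "Var i * Var j \<in> (vanishing (chain_covers P 1) 1 :: ('v, 'k) mpoly set)"
    if "(i, j) \<notin> P" "(j, i) \<notin> P" for i j
    using that unfolding Var_def monomial_add[symmetric] monomial_in_vanishing_iff
    by (auto simp: chain_covers_def chain_unions_1 Chains_def)
  then show "incomparability_ideal P \<subseteq> (vanishing (chain_covers P 1) 1 :: ('v, 'k) mpoly set)"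
    unfolding incomparability_ideal_def by (intro ideal_generated_least vanishing_ideal) blast
  have idl: "ideal (incomparability_ideal P) (ring_of_type_algebra :: ('v, 'k) mpoly ring)"
    unfolding incomparability_ideal_def by (rule ideal_generated_ideal)
  show "vanishing (chain_covers P 1) 1 \<subseteq> (incomparability_ideal P :: ('v, 'k) mpoly set)"
    unfolding vanishing_subset_iff_monomials[OF idl]
  proof (intro allI impI)
    fix m :: "'v \<Rightarrow>\<^sub>0 nat"
    assume m: "\<forall>A\<in>chain_covers P 1. 1 \<le> deg_in A m"
    have "Poly_Mapping.keys m \<notin> Chains P"
    proof
      assume "Poly_Mapping.keys m \<in> Chains P"
      then have "- Poly_Mapping.keys m \<in> chain_covers P 1"
        by (auto simp: chain_covers_def chain_unions_1)
      with m show False unfolding deg_in_ge_1_iff by blast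
    qed
    then obtain i j where ij: "i \<in> Poly_Mapping.keys m" "j \<in> Poly_Mapping.keys m" "(i, j) \<notin> P" "(j, i) \<notin> P"
      by (auto simp: Chains_def)
    \<comment> \<open>Distinctness keeps the exponents of \<open>?n\<close> at most 1, so that it
      divides \<open>m\<close>.\<close>
    then have "i \<noteq> j" using assms by (auto simp: refl_on_def)
    let ?n = "Poly_Mapping.single i 1 + Poly_Mapping.single j 1"
    have "(monomial m :: ('v, 'k) mpoly) = monomial (m - ?n) * monomial ?n"
      using ij \<open>i \<noteq> j\<close> by (intro monomial_dvd) (auto simp: lookup_add lookup_single when_def in_keys_iff)
    moreover have "monomial ?n \<in> (incomparability_ideal P :: ('v, 'k) mpoly set)"
      unfolding incomparability_ideal_def
      by (rule ideal_generated_base) (use ij in \<open>auto simp: Var_def mult_single\<close>)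
    ultimately show "(monomial m :: ('v, 'k) mpoly) \<in> incomparability_ideal P"
      using ideal_typeD(3)[OF idl] by metis
  qed
qed

text \<open>Intersecting complements unites the chains, so by \<open>join_vanishing\<close> each
  further join adds one chain.\<close>

lemma secant_ideal_eq_vanishing:
  fixes P :: "'v::finite rel"
  assumes "refl P" "1 \<le> r"
  shows "secant_ideal (incomparability_ideal P) r =
           (vanishing (chain_covers P r) 1 :: ('v, 'k::comm_ring_1) mpoly set)"
proof -
  let ?J = "incomparability_ideal P :: ('v, 'k) mpoly set"
  have "{A \<inter> B |A B. A \<in> chain_covers P 1 \<and> B \<in> chain_covers P r} = chain_covers P (Suc r)" for r
  proof (intro Set.set_eqI iffI)
    fix D assume "D \<in> {A \<inter> B |A B. A \<in> chain_covers P 1 \<and> B \<in> chain_covers P r}"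
    then obtain C E where "D = - C \<inter> - E" "C \<in> Chains P" "E \<in> chain_unions P r"
      by (auto simp: chain_covers_def chain_unions_1)
    moreover from this have "C \<union> E \<in> chain_unions P (Suc r)"
      by (auto simp: chain_unions_Suc)
    ultimately show "D \<in> chain_covers P (Suc r)"
      unfolding chain_covers_def by (intro CollectI exI[of _ "C \<union> E"]) simp
  next
    fix D assume "D \<in> chain_covers P (Suc r)"
    then obtain C E where "D = - C \<inter> - E" "C \<in> Chains P" "E \<in> chain_unions P r"
      by (auto simp: chain_covers_def chain_unions_Suc)
    moreover from this have "- C \<in> chain_covers P 1" "- E \<in> chain_covers P r"
      by (auto simp: chain_covers_def chain_unions_1)
    ultimately show "D \<in> {A \<inter> B |A B. A \<in> chain_covers P 1 \<and> B \<in> chain_covers P r}"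
      by blast
  qed
  then have step: "join_ideal ?J (vanishing (chain_covers P r) 1) = vanishing (chain_covers P (Suc r)) 1" for r
    unfolding incomparability_ideal_eq_vanishing[OF assms(1)] join_vanishing by simp
  \<comment> \<open>\<open>k\<close> joins involve \<open>k + 1\<close> copies of the ideal.\<close>
  have "(join_ideal ?J ^^ k) ?J = vanishing (chain_covers P (Suc k)) 1" for k
  proof (induction k)
    case 0
    show ?case using incomparability_ideal_eq_vanishing[OF assms(1)] by simp
  qed (simp add: step[unfolded One_nat_def])
  from this[of "r - 1"] show ?thesis
    using assms(2) by (simp add: secant_ideal_def)
qed

lemma symbolic_power_secant_ideal:
  fixes P :: "'v::finite rel"
  assumes "refl P" "1 \<le> r" "1 \<le> s"
  shows "symbolic_power (secant_ideal (incomparability_ideal P) r) s =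
           (vanishing (chain_covers P r) s :: ('v, 'k::idom) mpoly set)"
proof -
  have "{} \<in> chain_unions P r"
    unfolding chain_unions_def by (auto simp: Chains_def intro!: exI[of _ "\<lambda>_. {}"])
  then have "chain_covers P r \<noteq> {}" by (auto simp: chain_covers_def)
  then show ?thesis
    unfolding secant_ideal_eq_vanishing[OF assms(1,2)] using assms(3) by (rule symbolic_power_vanishing)
qed

text \<open>The claimed generators. Lists allow repeated antichains; the natural number subtraction
  is exact because each antichain has more than \<open>r\<close> elements.\<close>

definition antichain_products :: "'v rel \<Rightarrow> nat \<Rightarrow> nat \<Rightarrow> ('v, 'k::comm_ring_1) mpoly set" where
  "antichain_products P r s = {\<Prod>A\<leftarrow>As. squarefree_monomial A |As.
     As \<noteq> [] \<and> set As \<subseteq> antichains P (r + 1) \<and> (\<Sum>A\<leftarrow>As. card A - r) = s}"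

text \<open>A union of \<open>r\<close> chains contains at most \<open>r\<close> elements of
  \<open>A\<close>, so at least \<open>card A - r\<close> variables remain outside.\<close>

lemma squarefree_monomial_antichain:
  fixes P :: "'v::finite rel"
  assumes "A \<in> antichains P k"
  shows "(squarefree_monomial A :: ('v, 'k::comm_ring_1) mpoly) \<in> vanishing (chain_covers P r) (card A - r)"
  unfolding squarefree_monomial_eq monomial_in_vanishing_iff
proof
  fix B assume "B \<in> chain_covers P r"
  then obtain C where C: "B = - C" "C \<in> chain_unions P r" by (auto simp: chain_covers_def)
  have "card (A \<inter> C) \<le> r"
    by (rule card_antichain_Int_chain_union[OF assms C(2)])
  moreover have "card A = card (A \<inter> C) + card (A \<inter> B)"
    unfolding C(1) by (subst card_Un_disjoint[symmetric]) (auto intro!: arg_cong[where f = card])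
  ultimately show "card A - r \<le> deg_in B (set_monomial A)"
    by (simp add: deg_in_set_monomial)
qed

lemma antichain_product_in_vanishing:
  fixes P :: "'v::finite rel"
  assumes "set As \<subseteq> antichains P k"
  shows "((\<Prod>A\<leftarrow>As. squarefree_monomial A) :: ('v, 'k::comm_ring_1) mpoly)
           \<in> vanishing (chain_covers P r) (\<Sum>A\<leftarrow>As. card A - r)"
  using assms
proof (induction As)
  case Nil
  then show ?case by (simp add: vanishing_def)
next
  case (Cons A As)
  then show ?case
    by (auto intro!: vanishing_mult squarefree_monomial_antichain)
qed

text \<open>With the exponents of a monomial as multiplicities, \<open>chain_union_duality\<close>
  produces a generator dividing it. The ideal \<open>I\<close> is arbitrary so that the lemma serves
  both the generated ideal and the sum of ideals in the definition of differential
  perfection.\<close>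

lemma vanishing_subset_of_antichain_products:
  fixes P :: "'v::finite rel" and I :: "('v, 'k::comm_ring_1) mpoly set"
  assumes poset: "partial_order_on UNIV P" and "1 \<le> r" "1 \<le> s"
    and I: "ideal I ring_of_type_algebra" "antichain_products P r s \<subseteq> I"
  shows "vanishing (chain_covers P r) s \<subseteq> I"
  unfolding vanishing_subset_iff_monomials[OF I(1)]
proof (intro allI impI)
  fix m :: "'v \<Rightarrow>\<^sub>0 nat"
  assume m: "\<forall>A\<in>chain_covers P r. s \<le> deg_in A m"
  have "s \<le> sum (Poly_Mapping.lookup m) (- C)" if "C \<in> chain_unions P r" for C
    using m that unfolding deg_in_def chain_covers_def by blast
  from chain_union_duality[OF poset \<open>1 \<le> r\<close> this] obtain Bs where
    Bs: "set Bs \<subseteq> antichains P (r + 1)" "\<And>v. (\<Sum>A\<leftarrow>Bs. of_bool (v \<in> A)) \<le> Poly_Mapping.lookup m v"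
      "s \<le> (\<Sum>A\<leftarrow>Bs. card A - r)"
    by blast
  from trim_antichains[OF Bs(1,3)] obtain As where
    As: "set As \<subseteq> antichains P (r + 1)" "(\<Sum>A\<leftarrow>As. card A - r) = s"
      "\<And>v. (\<Sum>A\<leftarrow>As. of_bool (v \<in> A)) \<le> (\<Sum>A\<leftarrow>Bs. of_bool (v \<in> A) :: nat)"
    by blast
  have "As \<noteq> []" using As(2) \<open>1 \<le> s\<close> by auto
  with As have mem: "(\<Prod>A\<leftarrow>As. squarefree_monomial A) \<in> I"
    using I(2) unfolding antichain_products_def by blast
  have eq: "(\<Prod>A\<leftarrow>As. squarefree_monomial A :: ('v, 'k) mpoly) = monomial (\<Sum>A\<leftarrow>As. set_monomial A)" for As
    by (induction As) (simp_all add: squarefree_monomial_eq monomial_add)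
  have lookup: "Poly_Mapping.lookup (\<Sum>A\<leftarrow>As. set_monomial A) v = (\<Sum>A\<leftarrow>As. of_bool (v \<in> A))" for As :: "'v set list" and v
    by (induction As) (simp_all add: lookup_add lookup_set_monomial)
  have "(monomial m :: ('v, 'k) mpoly) = monomial (m - (\<Sum>A\<leftarrow>As. set_monomial A)) * monomial (\<Sum>A\<leftarrow>As. set_monomial A)"
    using order_trans[OF As(3) Bs(2)] by (intro monomial_dvd) (simp add: lookup)
  with mem show "monomial m \<in> I"
    unfolding eq using ideal_typeD(3)[OF I(1)] by metis
qed

lemma antichain_products_subset_vanishing:
  "antichain_products P r s \<subseteq> (vanishing (chain_covers P r) s :: ('v::finite, 'k::comm_ring_1) mpoly set)"
  unfolding antichain_products_def using antichain_product_in_vanishing by fastforce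

lemma vanishing_eq_ideal_generated:
  fixes P :: "'v::finite rel"
  assumes "partial_order_on UNIV P" "1 \<le> r" "1 \<le> s"
  shows "vanishing (chain_covers P r) s = (ideal_generated (antichain_products P r s) :: ('v, 'k::comm_ring_1) mpoly set)"
proof
  show "vanishing (chain_covers P r) s \<subseteq> (ideal_generated (antichain_products P r s) :: ('v, 'k) mpoly set)"
    by (intro vanishing_subset_of_antichain_products[OF assms] ideal_generated_ideal)
      (blast intro: ideal_generated_base)
qed (intro ideal_generated_least vanishing_ideal antichain_products_subset_vanishing)

text \<open>A monomial of degree less than \<open>s\<close> in the variables outside \<open>C\<close> is supported on \<open>C\<close> and at
  most \<open>s - 1\<close> further one-element chains.\<close>

lemma vanishing_chain_covers_shift:
  fixes P :: "'v::finite rel"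
  assumes "refl P" "1 \<le> s"
  shows "vanishing (chain_covers P (r + s - 1)) 1 \<subseteq> (vanishing (chain_covers P r) s :: ('v, 'k::comm_ring_1) mpoly set)"
  unfolding vanishing_subset_iff_monomials[OF vanishing_ideal] monomial_in_vanishing_iff
proof (intro allI impI ballI)
  fix m :: "'v \<Rightarrow>\<^sub>0 nat" and B
  assume m: "\<forall>A\<in>chain_covers P (r + s - 1). 1 \<le> deg_in A m" and "B \<in> chain_covers P r"
  then obtain C where C: "B = - C" "C \<in> chain_unions P r" by (auto simp: chain_covers_def)
  show "s \<le> deg_in B m"
  proof (rule ccontr)
    assume "\<not> s \<le> deg_in B m"
    define F where "F = Poly_Mapping.keys m \<inter> B"
    have "card F = (\<Sum>i\<in>F. 1)" by simp
    also have "\<dots> \<le> (\<Sum>i\<in>F. Poly_Mapping.lookup m i)"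
      by (intro sum_mono) (auto simp: F_def in_keys_iff)
    also have "\<dots> \<le> deg_in B m"
      unfolding deg_in_def by (intro sum_mono2) (auto simp: F_def)
    finally have "card F \<le> s - 1"
      using \<open>\<not> s \<le> deg_in B m\<close> by simp
    then have "C \<union> F \<in> chain_unions P (r + s - 1)"
      using chain_unions_Un_finite[OF assms(1) C(2), of F "s - 1"] assms(2) by simp
    then have "- (C \<union> F) \<in> chain_covers P (r + s - 1)"
      by (auto simp: chain_covers_def)
    with m have "Poly_Mapping.keys m \<inter> - (C \<union> F) \<noteq> {}"
      unfolding deg_in_ge_1_iff by blast
    then show False using C(1) by (auto simp: F_def)
  qed
qed

section \<open>Sums of ideals and differential perfection\<close>

lemma set_plus_ideal:
  assumes "ideal I (ring_of_type_algebra :: 'a::comm_ring_1 ring)" "ideal J (ring_of_type_algebra :: 'a ring)"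
  shows "ideal (I + J) (ring_of_type_algebra :: 'a ring)"
  unfolding ideal_type_iff
proof (intro conjI ballI allI)
  note I = ideal_typeD[OF assms(1)] and J = ideal_typeD[OF assms(2)]
  show "0 \<in> I + J" using set_plus_intro[OF I(1) J(1)] by simp
  fix a assume "a \<in> I + J"
  then obtain i j where a: "a = i + j" "i \<in> I" "j \<in> J" by (auto simp: set_plus_def)
  show "x * a \<in> I + J" for x
    using set_plus_intro[OF I(3)[OF a(2)] J(3)[OF a(3)]] by (simp add: a distrib_left)
  fix b assume "b \<in> I + J"
  then obtain i' j' where b: "b = i' + j'" "i' \<in> I" "j' \<in> J" by (auto simp: set_plus_def)
  show "a + b \<in> I + J"
    using set_plus_intro[OF I(2)[OF a(2) b(2)] J(2)[OF a(3) b(3)]] by (simp add: a b algebra_simps)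
qed

lemma set_sum_ideal:
  assumes "finite T" "\<And>t. t \<in> T \<Longrightarrow> ideal (I t) (ring_of_type_algebra :: 'a::comm_ring_1 ring)"
  shows "ideal (\<Sum>t\<in>T. I t) (ring_of_type_algebra :: 'a ring)"
  using assms
  by (induction T rule: finite_induct) (auto simp: set_plus_ideal ideal_type_iff[of "{0}"])

lemma set_sum_subset_ideal:
  assumes "finite T" "ideal K (ring_of_type_algebra :: 'a::comm_ring_1 ring)" "\<And>t. t \<in> T \<Longrightarrow> I t \<subseteq> K"
  shows "(\<Sum>t\<in>T. I t) \<subseteq> K"
proof
  fix a assume "a \<in> (\<Sum>t\<in>T. I t)"
  then obtain g where "a = sum g T" "\<forall>t\<in>T. g t \<in> I t"
    unfolding set_sum_alt[OF assms(1)] by blast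
  then show "a \<in> K"
    using assms(3) by (auto intro!: ideal_typeD(5)[OF assms(2)])
qed

lemma subset_set_sum:
  assumes "finite T" "\<And>t. t \<in> T \<Longrightarrow> 0 \<in> I t" "t \<in> T"
  shows "I t \<subseteq> (\<Sum>t\<in>T. I t :: 'a::comm_monoid_add set)"
proof
  fix a assume "a \<in> I t"
  then have "\<forall>u\<in>T. (if u = t then a else 0) \<in> I u" using assms(2) by simp
  moreover have "a = (\<Sum>u\<in>T. if u = t then a else 0)" using assms by (simp add: sum.delta)
  ultimately show "a \<in> (\<Sum>t\<in>T. I t)"
    unfolding set_sum_alt[OF assms(1)] by (intro CollectI exI[of _ "\<lambda>u. if u = t then a else 0"]) simp
qed

text \<open>The inclusion into the sum is checked on antichain products: one antichain alone lies in
  the secant ideal, and otherwise the first antichain splits off a factor.\<close>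

lemma r_differentially_perfect_incomparability_ideal:
  fixes P :: "'v::finite rel"
  assumes poset: "partial_order_on UNIV P" and r: "1 \<le> r"
  shows "r_differentially_perfect r (incomparability_ideal P :: ('v, 'k::idom) mpoly set)"
  unfolding r_differentially_perfect_def
proof (intro allI impI)
  fix s :: nat assume s: "s \<ge> 1"
  let ?J = "incomparability_ideal P :: ('v, 'k) mpoly set"
  let ?V = "\<lambda>r s. vanishing (chain_covers P r) s :: ('v, 'k) mpoly set"
  let ?M = "\<lambda>i. ideal_mult (?V r i) (?V r (s - i))"
  have refl_P: "refl P" using partial_order_onD(1)[OF poset] .
  have "?V r s = ?V (r + s - 1) 1 + (\<Sum>i = 1..s - 1. ?M i)" (is "_ = ?R")
  proof
    have M: "ideal (?M i) ring_of_type_algebra" for i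
      by (intro ideal_mult_ideal vanishing_ideal)
    then have sum: "ideal (\<Sum>i = 1..s - 1. ?M i) ring_of_type_algebra"
      by (intro set_sum_ideal) auto
    have "?M i \<subseteq> ?V r s" if "i \<in> {1..s - 1}" for i
    proof (rule ideal_mult_least[OF vanishing_ideal])
      fix f g assume "f \<in> ?V r i" "g \<in> ?V r (s - i)"
      then show "f * g \<in> ?V r s"
        using vanishing_mult[of f _ i g "s - i"] that by auto
    qed
    then have "(\<Sum>i = 1..s - 1. ?M i) \<subseteq> ?V r s"
      by (intro set_sum_subset_ideal vanishing_ideal) auto
    then show "?R \<subseteq> ?V r s"
      using vanishing_chain_covers_shift[OF refl_P s] ideal_typeD(2)[OF vanishing_ideal]
      by (fastforce simp: set_plus_def)
    show "?V r s \<subseteq> ?R"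
    proof (rule vanishing_subset_of_antichain_products[OF poset r s])
      show "ideal ?R ring_of_type_algebra"
        by (intro set_plus_ideal sum vanishing_ideal)
      show "antichain_products P r s \<subseteq> ?R"
      proof
        fix f :: "('v, 'k) mpoly" assume "f \<in> antichain_products P r s"
        then obtain As where As: "f = (\<Prod>A\<leftarrow>As. squarefree_monomial A)" "As \<noteq> []"
          "set As \<subseteq> antichains P (r + 1)" "(\<Sum>A\<leftarrow>As. card A - r) = s"
          by (auto simp: antichain_products_def)
        then obtain A Bs where AB: "As = A # Bs" by (cases As) auto
        have A: "A \<in> antichains P (r + 1)" "r + 1 \<le> card A"
          using As(3) by (auto simp: AB antichains_def)
        show "f \<in> ?R"
        proof (cases Bs)
          case Nil
          then have "card A = r + s" "f = squarefree_monomial A"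
            using As A by (auto simp: AB)
          \<comment> \<open>An antichain of \<open>r + s\<close> elements has at least one element
            outside any union of \<open>r + s - 1\<close> chains.\<close>
          then have "f \<in> ?V (r + s - 1) 1"
            using squarefree_monomial_antichain[OF A(1), of "r + s - 1"] s by simp
          from set_plus_intro[OF this ideal_typeD(1)[OF sum]] show ?thesis by simp
        next
          case (Cons B Cs)
          define i where "i = card A - r"
          have "r + 1 \<le> card B"
            using As(3) by (auto simp: AB Cons antichains_def)
          \<comment> \<open>Both \<open>A\<close> and \<open>B\<close> contribute at least 1 to the
            sum, so neither \<open>i\<close> nor \<open>s - i\<close> is 0.\<close>
          then have i: "i \<in> {1..s - 1}" "(\<Sum>A\<leftarrow>Bs. card A - r) = s - i"
            using As(4) A(2) by (auto simp: AB Cons i_def)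
          have "f = squarefree_monomial A * (\<Prod>A\<leftarrow>Bs. squarefree_monomial A)"
            using As(1) by (simp add: AB)
          also have "\<dots> \<in> ?M i"
            using squarefree_monomial_antichain[OF A(1), of r]
              antichain_product_in_vanishing[of Bs P "r + 1" r] As(3)
            by (intro ideal_mult_prod) (auto simp: AB i i_def[symmetric])
          finally have "f \<in> (\<Sum>i = 1..s - 1. ?M i)"
            using subset_set_sum[of "{1..s - 1}" ?M i] ideal_typeD(1)[OF M] i(1) by blast
          from set_plus_intro[OF ideal_typeD(1)[OF vanishing_ideal] this] show ?thesis by simp
        qed
      qed
    qed
  qed
  note V = this
  have "ideal_mult (symbolic_power (secant_ideal ?J r) i) (symbolic_power (secant_ideal ?J r) (s - i)) = ?M i"
    if "i \<in> {1..s - 1}" for i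
  proof -
    \<comment> \<open>The formula for symbolic powers is available for positive exponents, and both
      exponents are positive here.\<close>
    have "1 \<le> i" "1 \<le> s - i" using that by auto
    then show ?thesis by (simp only: symbolic_power_secant_ideal[OF refl_P r])
  qed
  then have products: "(\<Sum>i = 1..s - 1. ideal_mult (symbolic_power (secant_ideal ?J r) i)
      (symbolic_power (secant_ideal ?J r) (s - i))) = (\<Sum>i = 1..s - 1. ?M i)"
    by (rule sum.cong[OF refl])
  have "1 \<le> r + s - 1" using r s by simp
  then show "symbolic_power (secant_ideal ?J r) s = secant_ideal ?J (r + s - 1) +
      (\<Sum>i = 1..s - 1. ideal_mult (symbolic_power (secant_ideal ?J r) i)
                                    (symbolic_power (secant_ideal ?J r) (s - i)))"
    unfolding products symbolic_power_secant_ideal[OF refl_P r s]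
    by (simp only: secant_ideal_eq_vanishing[OF refl_P] V)
qed

theorem theorem4p2:
  fixes P :: "'n::finite rel"
    and J :: "('n, 'k::alg_closed_field) mpoly set"
  assumes poset: "partial_order_on UNIV P"
  defines "J \<equiv> incomparability_ideal P"
  shows "differentially_perfect J \<and>
    (\<forall>r s. r \<ge> 1 \<and> s \<ge> 1 \<longrightarrow>
       symbolic_power (secant_ideal J r) s =
       ideal_generated
         {\<Prod>A\<leftarrow>As. squarefree_monomial A |As.
            As \<noteq> [] \<and> set As \<subseteq> antichains P (r + 1) \<and> (\<Sum>A\<leftarrow>As. card A - r) = s})"
proof (intro conjI allI impI)
  show "differentially_perfect J"
    unfolding differentially_perfect_def J_def
    using r_differentially_perfect_incomparability_ideal[OF poset] by blast
  fix r s :: nat assume rs: "r \<ge> 1 \<and> s \<ge> 1"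
  show "symbolic_power (secant_ideal J r) s =
       ideal_generated
         {\<Prod>A\<leftarrow>As. squarefree_monomial A |As.
            As \<noteq> [] \<and> set As \<subseteq> antichains P (r + 1) \<and> (\<Sum>A\<leftarrow>As. card A - r) = s}"
    unfolding J_def antichain_products_def[symmetric]
    using rs partial_order_onD(1)[OF poset]
    by (simp add: symbolic_power_secant_ideal vanishing_eq_ideal_generated[OF poset])
qed

end
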